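(* Consider the system $$\begin{cases}\rho u_{tt}=\mu u_{xx}+b\varphi_{x}+d\psi_{x},\\ \kappa_{1}\varphi_{tt}=\alpha\varphi_{xx}+\beta\psi_{xx}-bu_{x}-\alpha_{1}\varphi-\alpha_{3}\psi-\tau_{1}\varphi_{t}-\tau_{2}\psi_{t},\\ \kappa_{2}\psi_{tt}=\beta\varphi_{xx}+\gamma\psi_{xx}-du_{x}-\alpha_{3}\varphi-\alpha_{2}\psi-\tau_{3}\varphi_{t}-\tau_{4}\psi_{t}\end{cases}\quad\text{in }(0,\pi)\times(0,\infty),$$ with boundary conditions $u(0,t)=u(\pi,t)=\varphi_x(0,t)=\varphi_x(\pi,t)=\psi_x(0,t)=\psi_x(\pi,t)=0$ for $t\ge 0$, and initial data in $\mathcal H$. Suppose that the condition "$\chi_0=0$ and $\chi_1\ne 0$" does not hold, i.e. $\chi_0\neq 0$ or $\chi_1=0$. Then the energy associated with the solution $(u,\varphi,\psi)$ is not exponentially stable: there are no constants $M,\xi>0$ such that $E(t)\le M E(0)e^{-\xi t}$ for all $t\ge 0$ and all solutions with initial data $(u,u_t,\varphi,\varphi_t,\psi,\psi_t)|_{t=0}\in\mathcal H$.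
   Context: Standing assumptions on the real coefficients: $\rho,\kappa_1,\kappa_2>0$; $\mu,\alpha,\beta,\gamma,\alpha_1,\alpha_2>0$; $b,d$ are not both zero; the symmetric matrix $$\begin{pmatrix}\mu&b&d&0&0\\ b&\alpha_1&\alpha_3&0&0\\ d&\alpha_3&\alpha_2&0&0\\ 0&0&0&\alpha&\beta\\ 0&0&0&\beta&\gamma\end{pmatrix}$$ is positive definite; $\tau_1>0$ and $4\tau_1\tau_4>(\tau_2+\tau_3)^2$. Energy space: $\mathcal H=H_0^1(0,\pi)\times L^2(0,\pi)\times H_*^1(0,\pi)\times L_*^2(0,\pi)\times H_*^1(0,\pi)\times L_*^2(0,\pi)$, where $L_*^2(0,\pi)=\{\phi\in L^2(0,\pi):\int_0^\pi\phi\,dx=0\}$ and $H_*^1(0,\pi)=\{\phi\in H^1(0,\pi):\int_0^\pi\phi\,dx=0\}$. Solutions are the weak (semigroup) solutions, with $(u,u_t,\varphi,\varphi_t,\psi,\psi_t)\in C([0,\infty);\mathcal H)$. Energy: $$E(t)=\frac12\int_0^\pi\big[\rho u_t^2+\kappa_1\varphi_t^2+\kappa_2\psi_t^2+\mu u_x^2+\alpha\varphi_x^2+\gamma\psi_x^2+\alpha_1\varphi^2+\alpha_2\psi^2+2\beta\varphi_x\psi_x+2bu_x\varphi+2du_x\psi+2\alpha_3\varphi\psi\big]dx.$$ Stability numbers: $$\chi_0=\Big(\frac{\mu\kappa_1}{\rho}-\alpha\Big)\Big(\frac{\mu\kappa_2}{\rho}-\gamma\Big)-\beta^2,\qquad \chi_1=d^2\Big(\frac{\mu\kappa_1}{\rho}-\alpha\Big)+b^2\Big(\frac{\mu\kappa_2}{\rho}-\gamma\Big)+2bd\beta.$$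 *)

theory Defs
  imports "HOL-Analysis.Analysis"
begin

section \<open>Function spaces on the interval $(0,\pi)$\<close>

text \<open>Elements of Lebesgue and Sobolev spaces are represented by functions on the real line;
  only their values almost everywhere on $(0,\pi)$ matter.\<close>

abbreviation leb :: "real measure" where
  "leb \<equiv> lebesgue_on {0<..<pi}"

definition L2 :: "(real \<Rightarrow> real) set" where
  "L2 = {f. f \<in> borel_measurable leb \<and> integrable leb (\<lambda>x. (f x)\<^sup>2)}"

definition L2_star :: "(real \<Rightarrow> real) set" where
  "L2_star = {f \<in> L2. (LINT x|leb. f x) = 0}"

definition test_functions :: "(real \<Rightarrow> real) set" where
  "test_functions = {\<eta>. \<eta> C1_differentiable_on UNIV \<and> closure {x. \<eta> x \<noteq> 0} \<subseteq> {0<..<pi}}"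

definition has_weak_deriv :: "(real \<Rightarrow> real) \<Rightarrow> (real \<Rightarrow> real) \<Rightarrow> bool" where
  "has_weak_deriv f g \<longleftrightarrow>
     (\<forall>\<eta>\<in>test_functions. (LINT x|leb. f x * deriv \<eta> x) = - (LINT x|leb. g x * \<eta> x))"

definition H1 :: "(real \<Rightarrow> real) set" where
  "H1 = {f \<in> L2. \<exists>g\<in>L2. has_weak_deriv f g}"

text \<open>The weak derivative of a function in \<open>H1\<close> is unique up to equality almost everywhere;
  \<open>wderiv\<close> selects a representative.\<close>

definition wderiv :: "(real \<Rightarrow> real) \<Rightarrow> real \<Rightarrow> real" where
  "wderiv f = (SOME g. g \<in> L2 \<and> has_weak_deriv f g)"

definition H2 :: "(real \<Rightarrow> real) set" where
  "H2 = {f \<in> H1. wderiv f \<in> H1}"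

text \<open>In one dimension every element of \<open>H1\<close> has a representative that is continuous on $[0,\pi]$;
  membership in \<open>H1_0\<close> says that this representative vanishes at both end points.\<close>

definition H1_0 :: "(real \<Rightarrow> real) set" where
  "H1_0 = {f \<in> H1. \<exists>g. continuous_on {0..pi} g \<and> g 0 = 0 \<and> g pi = 0 \<and> (AE x in leb. f x = g x)}"

definition H1_star :: "(real \<Rightarrow> real) set" where
  "H1_star = {f \<in> H1. (LINT x|leb. f x) = 0}"

definition norm_L2 :: "(real \<Rightarrow> real) \<Rightarrow> real" where
  "norm_L2 f = sqrt (LINT x|leb. (f x)\<^sup>2)"

definition norm_H1 :: "(real \<Rightarrow> real) \<Rightarrow> real" where
  "norm_H1 f = sqrt (LINT x|leb. (f x)\<^sup>2 + (wderiv f x)\<^sup>2)"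

section \<open>Functions of time with values in a function space\<close>

text \<open>Space-time functions take the time as their first argument: \<open>u t x\<close>. The predicates below
  concern the time interval $[0,\infty)$ and the topology of the seminorm \<open>N\<close>.\<close>

definition continuous_in :: "((real \<Rightarrow> real) \<Rightarrow> real) \<Rightarrow> (real \<Rightarrow> real \<Rightarrow> real) \<Rightarrow> bool" where
  "continuous_in N f \<longleftrightarrow>
     (\<forall>t\<ge>0. ((\<lambda>s. N (\<lambda>x. f s x - f t x)) \<longlongrightarrow> 0) (at t within {0..}))"

text \<open>For continuous \<open>f\<close> the following determines \<open>F t\<close>, up to equality almost everywhere, as the
  vector-valued integral $\int_0^t f(s)\,ds$.\<close>

definition primitive_in ::
  "((real \<Rightarrow> real) \<Rightarrow> real) \<Rightarrow> (real \<Rightarrow> real \<Rightarrow> real) \<Rightarrow> (real \<Rightarrow> real \<Rightarrow> real) \<Rightarrow> bool" where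
  "primitive_in N F f \<longleftrightarrow>
     (AE x in leb. F 0 x = 0) \<and>
     (\<forall>t\<ge>0. ((\<lambda>s. N (\<lambda>x. (F s x - F t x) / (s - t) - f t x)) \<longlongrightarrow> 0) (at t within {0..}))"

section \<open>The system\<close>

text \<open>States are sextuples \<open>(u, v, \<phi>, w, \<psi>, z)\<close> where \<open>v\<close>, \<open>w\<close>, \<open>z\<close> stand for the time derivatives
  $u_t$, $\varphi_t$, $\psi_t$.\<close>

type_synonym fun6 = "(real \<Rightarrow> real) \<times> (real \<Rightarrow> real) \<times> (real \<Rightarrow> real) \<times>
  (real \<Rightarrow> real) \<times> (real \<Rightarrow> real) \<times> (real \<Rightarrow> real)"

definition energy_space :: "fun6 set" where
  "energy_space = H1_0 \<times> L2 \<times> H1_star \<times> L2_star \<times> H1_star \<times> L2_star"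

text \<open>The domain of the generator of the associated semigroup. It carries the boundary conditions:
  $u$, $\varphi_x$ and $\psi_x$ vanish at $0$ and $\pi$.\<close>

definition generator_domain :: "fun6 set" where
  "generator_domain =
     {(u, v, \<phi>, w, \<psi>, z).
        u \<in> H2 \<inter> H1_0 \<and> v \<in> H1_0 \<and>
        \<phi> \<in> H2 \<inter> H1_star \<and> wderiv \<phi> \<in> H1_0 \<and> w \<in> H1_star \<and>
        \<psi> \<in> H2 \<inter> H1_star \<and> wderiv \<psi> \<in> H1_0 \<and> z \<in> H1_star}"

text \<open>Writing the system as $Y' = \mathcal{A} Y$ with $Y = (u,u_t,\varphi,\varphi_t,\psi,\psi_t)$, the
  semigroup solution with initial value $Y(0)$ in the energy space is its mild solution: the
  continuous $Y$ such that, for all $t \ge 0$, $\int_0^t Y(s)\,ds$ lies in the domain of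
  $\mathcal{A}$ and $Y(t) = Y(0) + \mathcal{A} \int_0^t Y(s)\,ds$. Below, the integral is
  \<open>(U t, V t, \<Phi> t, W t, \<Psi> t, Z t)\<close>, and the equations for the velocities are
  multiplied by \<open>\<rho>\<close>, \<open>\<kappa>1\<close>, \<open>\<kappa>2\<close>.\<close>

definition semigroup_solution ::
  "real \<Rightarrow> real \<Rightarrow> real \<Rightarrow> real \<Rightarrow> real \<Rightarrow> real \<Rightarrow> real \<Rightarrow> real \<Rightarrow> real \<Rightarrow> real \<Rightarrow> real \<Rightarrow> real \<Rightarrow>
   real \<Rightarrow> real \<Rightarrow> real \<Rightarrow> real \<Rightarrow>
   (real \<Rightarrow> real \<Rightarrow> real) \<Rightarrow> (real \<Rightarrow> real \<Rightarrow> real) \<Rightarrow> (real \<Rightarrow> real \<Rightarrow> real) \<Rightarrow>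
   (real \<Rightarrow> real \<Rightarrow> real) \<Rightarrow> (real \<Rightarrow> real \<Rightarrow> real) \<Rightarrow> (real \<Rightarrow> real \<Rightarrow> real) \<Rightarrow> bool" where
  "semigroup_solution \<rho> \<kappa>1 \<kappa>2 \<mu> \<alpha> \<beta> \<gamma> \<alpha>1 \<alpha>2 \<alpha>3 b d \<tau>1 \<tau>2 \<tau>3 \<tau>4 u v \<phi> w \<psi> z \<longleftrightarrow>
     (\<forall>t\<ge>0. (u t, v t, \<phi> t, w t, \<psi> t, z t) \<in> energy_space) \<and>
     continuous_in norm_H1 u \<and> continuous_in norm_L2 v \<and>
     continuous_in norm_H1 \<phi> \<and> continuous_in norm_L2 w \<and>
     continuous_in norm_H1 \<psi> \<and> continuous_in norm_L2 z \<and>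
     (\<exists>U V \<Phi> W \<Psi> Z.
        primitive_in norm_H1 U u \<and> primitive_in norm_L2 V v \<and>
        primitive_in norm_H1 \<Phi> \<phi> \<and> primitive_in norm_L2 W w \<and>
        primitive_in norm_H1 \<Psi> \<psi> \<and> primitive_in norm_L2 Z z \<and>
        (\<forall>t\<ge>0. (U t, V t, \<Phi> t, W t, \<Psi> t, Z t) \<in> generator_domain \<and>
          (AE x in leb.
             u t x = u 0 x + V t x \<and>
             \<rho> * v t x = \<rho> * v 0 x + \<mu> * wderiv (wderiv (U t)) x
               + b * wderiv (\<Phi> t) x + d * wderiv (\<Psi> t) x \<and>
             \<phi> t x = \<phi> 0 x + W t x \<and>
             \<kappa>1 * w t x = \<kappa>1 * w 0 x + \<alpha> * wderiv (wderiv (\<Phi> t)) x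
               + \<beta> * wderiv (wderiv (\<Psi> t)) x - b * wderiv (U t) x
               - \<alpha>1 * \<Phi> t x - \<alpha>3 * \<Psi> t x - \<tau>1 * W t x - \<tau>2 * Z t x \<and>
             \<psi> t x = \<psi> 0 x + Z t x \<and>
             \<kappa>2 * z t x = \<kappa>2 * z 0 x + \<beta> * wderiv (wderiv (\<Phi> t)) x
               + \<gamma> * wderiv (wderiv (\<Psi> t)) x - d * wderiv (U t) x
               - \<alpha>3 * \<Phi> t x - \<alpha>2 * \<Psi> t x - \<tau>3 * W t x - \<tau>4 * Z t x)))"

definition energy ::
  "real \<Rightarrow> real \<Rightarrow> real \<Rightarrow> real \<Rightarrow> real \<Rightarrow> real \<Rightarrow> real \<Rightarrow> real \<Rightarrow> real \<Rightarrow> real \<Rightarrow> real \<Rightarrow> real \<Rightarrow>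
   (real \<Rightarrow> real) \<Rightarrow> (real \<Rightarrow> real) \<Rightarrow> (real \<Rightarrow> real) \<Rightarrow>
   (real \<Rightarrow> real) \<Rightarrow> (real \<Rightarrow> real) \<Rightarrow> (real \<Rightarrow> real) \<Rightarrow> real" where
  "energy \<rho> \<kappa>1 \<kappa>2 \<mu> \<alpha> \<beta> \<gamma> \<alpha>1 \<alpha>2 \<alpha>3 b d u v \<phi> w \<psi> z =
     1/2 * (LINT x|leb.
       \<rho> * (v x)\<^sup>2 + \<kappa>1 * (w x)\<^sup>2 + \<kappa>2 * (z x)\<^sup>2
       + \<mu> * (wderiv u x)\<^sup>2 + \<alpha> * (wderiv \<phi> x)\<^sup>2 + \<gamma> * (wderiv \<psi> x)\<^sup>2
       + \<alpha>1 * (\<phi> x)\<^sup>2 + \<alpha>2 * (\<psi> x)\<^sup>2 + 2 * \<beta> * wderiv \<phi> x * wderiv \<psi> x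
       + 2 * b * wderiv u x * \<phi> x + 2 * d * wderiv u x * \<psi> x + 2 * \<alpha>3 * \<phi> x * \<psi> x)"

definition chi0 :: "real \<Rightarrow> real \<Rightarrow> real \<Rightarrow> real \<Rightarrow> real \<Rightarrow> real \<Rightarrow> real \<Rightarrow> real" where
  "chi0 \<rho> \<kappa>1 \<kappa>2 \<mu> \<alpha> \<beta> \<gamma> = (\<mu> * \<kappa>1 / \<rho> - \<alpha>) * (\<mu> * \<kappa>2 / \<rho> - \<gamma>) - \<beta>\<^sup>2"

definition chi1 ::
  "real \<Rightarrow> real \<Rightarrow> real \<Rightarrow> real \<Rightarrow> real \<Rightarrow> real \<Rightarrow> real \<Rightarrow> real \<Rightarrow> real \<Rightarrow> real" where
  "chi1 \<rho> \<kappa>1 \<kappa>2 \<mu> \<alpha> \<beta> \<gamma> b d =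
     d\<^sup>2 * (\<mu> * \<kappa>1 / \<rho> - \<alpha>) + b\<^sup>2 * (\<mu> * \<kappa>2 / \<rho> - \<gamma>) + 2 * b * d * \<beta>"

definition coefficient_matrix ::
  "real \<Rightarrow> real \<Rightarrow> real \<Rightarrow> real \<Rightarrow> real \<Rightarrow> real \<Rightarrow> real \<Rightarrow> real \<Rightarrow> real \<Rightarrow> real^5^5" where
  "coefficient_matrix \<mu> \<alpha> \<beta> \<gamma> \<alpha>1 \<alpha>2 \<alpha>3 b d = vector
     [vector [\<mu>, b,  d,  0, 0],
      vector [b, \<alpha>1, \<alpha>3, 0, 0],
      vector [d, \<alpha>3, \<alpha>2, 0, 0],
      vector [0, 0,  0,  \<alpha>, \<beta>],
      vector [0, 0,  0,  \<beta>, \<gamma>]]"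

definition positive_definite :: "real^'n^'n \<Rightarrow> bool" where
  "positive_definite A \<longleftrightarrow> transpose A = A \<and> (\<forall>y. y \<noteq> 0 \<longrightarrow> 0 < y \<bullet> (A *v y))"

end

theory Submission
  imports Defs "HOL-Computational_Algebra.Fundamental_Theorem_Algebra"
begin

text \<open>The system separates into Fourier modes: $u = A e^{\lambda t} \sin nx$,
  $\varphi = B e^{\lambda t} \cos nx$, $\psi = C e^{\lambda t} \cos nx$ is a (complex) solution exactly when
  $(A, B, C)$ lies in the kernel of a $3 \times 3$ matrix depending on $\lambda$ and $n$. Exponential
  stability at rate $\xi$ would force $\mathrm{Re}\,\lambda \le -\xi/2$ for every root $\lambda$ of the
  determinants $D_n(\lambda)$ of these matrices with $\mathrm{Im}\,\lambda \ne 0$. So it suffices to find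
  roots that come arbitrarily close to the imaginary axis.

  Such roots lie near $i \omega n$, where $\omega = \sqrt{\mu/\rho}$; these are the frequencies of the undamped
  wave equation $\rho u_{tt} = \mu u_{xx}$, since damping acts only on the other two equations. For
  any polynomial $p$ of degree $m$ with $p'(z_0) \ne 0$ there is a root within distance
  $m\,|p(z_0)|/|p'(z_0)|$ of $z_0$ (\<open>pderiv_bound_if_no_root_near\<close>), so that only the quotient
  $D_n(i\omega n)/D_n'(i\omega n)$ has to be estimated. It tends to $0$ in both cases left by the
  hypothesis on the stability numbers (\<open>dispersion_newton_correction_vanishes\<close>). In the case
  $\chi_0 = \chi_1 = 0$ this uses that the dissipation form of $\tau_1, \dots, \tau_4$ is definite.

  Taking real parts gives real semigroup solutions (\<open>exponential_mode_solution\<close>). Their initial energy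
  is positive because the coefficient matrix is positive definite, and at full periods of the
  oscillation the energy is $e^{2 t\,\mathrm{Re}\,\lambda}$ times the initial energy. If
  $2\,\mathrm{Re}\,\lambda > -\xi/2$, this contradicts the assumed decay.

  The analytic part relates the weak notions to classical calculus: a weak derivative is determined
  almost everywhere (\<open>weak_deriv_unique\<close>), so that the derivative selected by \<open>wderiv\<close> coincides almost
  everywhere with the classical one for smooth functions.\<close>

section \<open>Integrals over the interval and test functions\<close>

lemma continuous_measurable_leb:
  "continuous_on UNIV f \<Longrightarrow> f \<in> borel_measurable leb" for f :: "real \<Rightarrow> real"
  by (intro measurable_restrict_space1 measurable_completion) (simp add: borel_measurable_continuous_onI)

lemma continuous_bounded_leb:
  fixes f :: "real \<Rightarrow> real"
  assumes "continuous_on UNIV f"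
  obtains C where "\<And>x. x \<in> {0<..<pi} \<Longrightarrow> \<bar>f x\<bar> \<le> C"
proof -
  have "compact (f ` {0..pi})"
    by (intro compact_continuous_image continuous_on_subset[OF assms]) auto
  then have "bounded (f ` {0..pi})" by (rule compact_imp_bounded)
  then obtain C where C: "\<forall>y\<in>f ` {0..pi}. norm y \<le> C" unfolding bounded_iff by blast
  show ?thesis by (rule that[of C]) (use C in auto)
qed

lemma finite_measure_leb: "finite_measure leb"
  by (intro finite_measure_lebesgue_on) auto

lemma continuous_integrable_leb:
  fixes f :: "real \<Rightarrow> real"
  assumes "continuous_on UNIV f"
  shows "integrable leb f"
proof -
  obtain C where "\<And>x. x \<in> {0<..<pi} \<Longrightarrow> \<bar>f x\<bar> \<le> C"
    using continuous_bounded_leb[OF assms] by blast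
  then show ?thesis
    using continuous_measurable_leb[OF assms]
    by (intro finite_measure.integrable_const_bound[OF finite_measure_leb, of f C]) auto
qed

lemma LINT_leb_FTC:
  assumes "\<And>x. (F has_real_derivative f x) (at x)" "continuous_on UNIV f"
  shows "(LINT x|leb. f x) = F pi - F 0"
proof -
  have "(f has_integral F pi - F 0) {0..pi}"
    using assms(1) by (intro fundamental_theorem_of_calculus)
      (auto simp: has_real_derivative_iff_has_vector_derivative intro: has_vector_derivative_at_within)
  then have "integral {0<..<pi} f = F pi - F 0"
    by (simp add: has_integral_Icc_iff_Ioo integral_unique)
  then show ?thesis
    by (simp add: lebesgue_integral_eq_integral[OF continuous_integrable_leb[OF assms(2)]])
qed

lemma continuous_L2:
  fixes f :: "real \<Rightarrow> real"
  assumes "continuous_on UNIV f"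
  shows "f \<in> L2"
  unfolding L2_def using assms
  by (auto intro!: continuous_measurable_leb continuous_integrable_leb continuous_intros)

lemma L2_mult_continuous_integrable:
  fixes f :: "real \<Rightarrow> real"
  assumes "f \<in> L2" "continuous_on UNIV e"
  shows "integrable leb (\<lambda>x. f x * e x)"
proof (rule Bochner_Integration.integrable_bound)
  show "integrable leb (\<lambda>x. (f x)\<^sup>2 + (e x)\<^sup>2)"
    using assms(1) continuous_integrable_leb[OF continuous_on_power[OF assms(2), of 2]]
    by (simp add: L2_def)
  show "(\<lambda>x. f x * e x) \<in> borel_measurable leb"
    using assms continuous_measurable_leb by (auto simp: L2_def)
  have "\<bar>a * b\<bar> \<le> a\<^sup>2 + b\<^sup>2" for a b :: real
    using sum_squares_bound[of "\<bar>a\<bar>" "\<bar>b\<bar>"] mult_nonneg_nonneg[of "\<bar>a\<bar>" "\<bar>b\<bar>"]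
    unfolding abs_mult power2_abs by linarith
  then show "AE x in leb. norm (f x * e x) \<le> norm ((f x)\<^sup>2 + (e x)\<^sup>2)"
    by simp
qed

lemma test_functionD:
  assumes "\<eta> \<in> test_functions"
  shows "(\<eta> has_real_derivative deriv \<eta> x) (at x)" "continuous_on UNIV (deriv \<eta>)"
    "\<eta> 0 = 0" "\<eta> pi = 0" "continuous_on UNIV \<eta>"
proof -
  obtain D where D: "\<And>x. (\<eta> has_vector_derivative D x) (at x)" "continuous_on UNIV D"
    using assms by (auto simp: test_functions_def C1_differentiable_on_def)
  have "D = deriv \<eta>"
    using D(1) by (metis DERIV_imp_deriv ext has_real_derivative_iff_has_vector_derivative)
  then show 1: "(\<eta> has_real_derivative deriv \<eta> x) (at x)" "continuous_on UNIV (deriv \<eta>)" for x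
    using D by (auto simp: has_real_derivative_iff_has_vector_derivative)
  show "continuous_on UNIV \<eta>"
    using 1(1) DERIV_isCont by (blast intro: continuous_at_imp_continuous_on)
  have "x \<in> {0<..<pi}" if "\<eta> x \<noteq> 0" for x
    using assms closure_subset[of "{x. \<eta> x \<noteq> 0}"] that unfolding test_functions_def by blast
  then show "\<eta> 0 = 0" "\<eta> pi = 0" by force+
qed

text \<open>Integration by parts: the boundary terms vanish with the test function.\<close>

lemma C1_has_weak_deriv:
  assumes g: "\<And>x. (g has_real_derivative g' x) (at x)" "continuous_on UNIV g'"
  shows "has_weak_deriv g g'"
  unfolding has_weak_deriv_def
proof
  fix \<eta> assume \<eta>: "\<eta> \<in> test_functions"
  note \<eta>D = test_functionD[OF \<eta>]
  have cg: "continuous_on UNIV g"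
    using g(1) DERIV_isCont by (blast intro: continuous_at_imp_continuous_on)
  have "(LINT x|leb. g x * deriv \<eta> x + g' x * \<eta> x) = g pi * \<eta> pi - g 0 * \<eta> 0"
  proof (rule LINT_leb_FTC)
    show "((\<lambda>x. g x * \<eta> x) has_real_derivative g x * deriv \<eta> x + g' x * \<eta> x) (at x)" for x
      using DERIV_mult[OF g(1) \<eta>D(1)] by (simp add: algebra_simps)
  qed (intro continuous_intros cg g \<eta>D)
  moreover have "integrable leb (\<lambda>x. g x * deriv \<eta> x)" "integrable leb (\<lambda>x. g' x * \<eta> x)"
    by (intro continuous_integrable_leb continuous_intros cg g \<eta>D)+
  ultimately show "(LINT x|leb. g x * deriv \<eta> x) = - (LINT x|leb. g' x * \<eta> x)"
    using \<eta>D by simp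
qed

text \<open>A test function approximating the indicator of the interval from \<open>a\<close> to \<open>b\<close>. With a
  nonnegative function $g$ that is positive exactly on the open interval, $kg/(1+kg)$ stays between
  $0$ and $1$ and tends to the indicator as $k \to \infty$. Squared positive parts make $g$
  continuously differentiable, and shrinking the interval by $1/(k+1)$ at both ends keeps the
  support away from the end points even when \<open>a = 0\<close> or \<open>b = pi\<close>.\<close>

definition bump :: "real \<Rightarrow> real \<Rightarrow> nat \<Rightarrow> real \<Rightarrow> real" where
  "bump a b k x = (let g = real k * ((max 0 (x - a - 1 / Suc k))\<^sup>2 * (max 0 (b - 1 / Suc k - x))\<^sup>2)
    in g / (1 + g))"

lemma max_0_sq_deriv: "((\<lambda>x. (max 0 x)\<^sup>2) has_real_derivative 2 * max 0 x) (at x)" for x :: real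
proof (cases x "0::real" rule: linorder_cases)
  case less
  have "((\<lambda>x. 0) has_real_derivative 0) (at x)" by simp
  then have "((\<lambda>x::real. (max 0 x)\<^sup>2) has_real_derivative 0) (at x)"
    by (rule has_field_derivative_transform_within_open[of _ _ _ "{..<0}"]) (use less in auto)
  then show ?thesis using less by simp
next
  case greater
  have "((\<lambda>x. x\<^sup>2) has_real_derivative 2 * x) (at x)" by (auto intro!: derivative_eq_intros)
  then have "((\<lambda>x::real. (max 0 x)\<^sup>2) has_real_derivative 2 * x) (at x)"
    by (rule has_field_derivative_transform_within_open[of _ _ _ "{0<..}"]) (use greater in auto)
  then show ?thesis using greater by simp
next
  case equal
  have *: "((\<lambda>h::real. max 0 h) \<longlongrightarrow> 0) (at 0)" by (auto intro!: tendsto_eq_intros)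
  have "((\<lambda>h::real. (max 0 h)\<^sup>2 / h) \<longlongrightarrow> 0) (at 0)"
    by (rule Lim_transform_eventually[OF *])
      (auto simp: eventually_at_filter max_def power2_eq_square)
  then show ?thesis using equal by (simp add: DERIV_def)
qed

lemma bump_test_function:
  assumes "0 \<le> a" "b \<le> pi"
  shows "bump a b k \<in> test_functions"
proof -
  define e where "e = 1 / real (Suc k)"
  have e: "e > 0" by (simp add: e_def)
  define g where "g = (\<lambda>x. real k * ((max 0 (x - a - e))\<^sup>2 * (max 0 (b - e - x))\<^sup>2))"
  define g' where "g' = (\<lambda>x. real k * (2 * max 0 (x - a - e) * (max 0 (b - e - x))\<^sup>2
     - (max 0 (x - a - e))\<^sup>2 * (2 * max 0 (b - e - x))))"
  have bump: "bump a b k = (\<lambda>x. g x / (1 + g x))"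
    by (simp add: fun_eq_iff bump_def g_def e_def Let_def)
  have g0: "g x \<ge> 0" for x by (simp add: g_def)
  have dg: "(g has_real_derivative g' x) (at x)" for x
  proof -
    have 1: "((\<lambda>x. (max 0 (x - a - e))\<^sup>2) has_real_derivative 2 * max 0 (x - a - e) * 1) (at x)"
      by (rule DERIV_chain2[OF max_0_sq_deriv]) (auto intro!: derivative_eq_intros)
    have 2: "((\<lambda>x. (max 0 (b - e - x))\<^sup>2) has_real_derivative 2 * max 0 (b - e - x) * (-1)) (at x)"
      by (rule DERIV_chain2[OF max_0_sq_deriv]) (auto intro!: derivative_eq_intros)
    show ?thesis unfolding g_def g'_def
      by (rule DERIV_cong[OF DERIV_cmult[OF DERIV_mult[OF 1 2]]]) (simp add: algebra_simps)
  qed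
  have cont: "continuous_on UNIV g" "continuous_on UNIV g'"
    unfolding g_def g'_def by (intro continuous_intros)+
  have ne: "1 + g x \<noteq> 0" for x using g0[of x] by linarith
  have "((\<lambda>x. g x / (1 + g x)) has_real_derivative g' x / (1 + g x)\<^sup>2) (at x)" for x
    using ne[of x] by (auto intro!: derivative_eq_intros dg simp: field_simps power2_eq_square)
  moreover have "continuous_on UNIV (\<lambda>x. g' x / (1 + g x)\<^sup>2)"
    using ne by (intro continuous_intros cont) auto
  ultimately have "bump a b k C1_differentiable_on UNIV"
    unfolding bump C1_differentiable_on_def has_real_derivative_iff_has_vector_derivative
    by (intro exI[of _ "\<lambda>x. g' x / (1 + g x)\<^sup>2"]) auto
  moreover have "closure {x. bump a b k x \<noteq> 0} \<subseteq> {a + e..b - e}"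
    by (rule closure_minimal) (auto simp: bump g_def max_def split: if_splits)
  then have "closure {x. bump a b k x \<noteq> 0} \<subseteq> {0<..<pi}"
    using e assms by (force simp: subset_eq)
  ultimately show ?thesis by (simp add: test_functions_def)
qed

lemma bump_bound: "\<bar>bump a b k x\<bar> \<le> 1"
proof -
  have "\<bar>g / (1 + g)\<bar> \<le> 1" if "g \<ge> 0" for g :: real using that by (simp add: field_simps)
  from this[of "real k * ((max 0 (x - a - 1 / Suc k))\<^sup>2 * (max 0 (b - 1 / Suc k - x))\<^sup>2)"]
  show ?thesis unfolding bump_def Let_def by (simp only: mult_nonneg_nonneg zero_le_power2 of_nat_0_le_iff)
qed

lemma bump_tendsto: "(\<lambda>k. bump a b k x) \<longlonglongrightarrow> indicator {a<..<b} x"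
proof (cases "x \<in> {a<..<b}")
  case True
  have e: "(\<lambda>k. 1 / real (Suc k)) \<longlonglongrightarrow> 0"
    by (rule LIMSEQ_Suc[OF lim_1_over_n])
  have "(\<lambda>k. (max 0 (x - a - 1 / real (Suc k)))\<^sup>2 * (max 0 (b - 1 / real (Suc k) - x))\<^sup>2)
     \<longlonglongrightarrow> (max 0 (x - a - 0))\<^sup>2 * (max 0 (b - 0 - x))\<^sup>2"
    by (intro tendsto_intros e)
  moreover have "(max 0 (x - a - 0))\<^sup>2 * (max 0 (b - 0 - x))\<^sup>2 > 0" using True by simp
  ultimately have g: "filterlim (\<lambda>k. ((max 0 (x - a - 1 / real (Suc k)))\<^sup>2 * (max 0 (b - 1 / real (Suc k) - x))\<^sup>2) * real k) at_top sequentially"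
    by (rule filterlim_tendsto_pos_mult_at_top) (rule filterlim_real_sequentially)
  have "((\<lambda>g::real. g / (1 + g)) \<longlongrightarrow> 1) at_top"
  proof -
    have "((\<lambda>g::real. 1 - inverse (1 + g)) \<longlongrightarrow> 1 - 0) at_top"
      by (intro tendsto_intros tendsto_inverse_0_at_top filterlim_tendsto_add_at_top[OF tendsto_const] filterlim_ident)
    moreover have "eventually (\<lambda>g::real. 1 - inverse (1 + g) = g / (1 + g)) at_top"
      using eventually_gt_at_top[of 0] by eventually_elim (simp add: field_simps)
    ultimately show ?thesis by (simp add: Lim_transform_eventually)
  qed
  from filterlim_compose[OF this g] show ?thesis
    using True by (simp add: bump_def Let_def mult.commute mult.left_commute)
next
  case False
  then have "bump a b k x = 0" for k
  proof -
    have "1 / real (Suc k) \<ge> 0" by simp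
    moreover have "x \<le> a \<or> b \<le> x" using False by auto
    ultimately have "max 0 (x - a - 1 / Suc k) = 0 \<or> max 0 (b - 1 / Suc k - x) = 0"
      unfolding max_def by argo
    then show ?thesis by (auto simp: bump_def Let_def)
  qed
  then show ?thesis using False by simp
qed

lemma L2_integrable: "f \<in> L2 \<Longrightarrow> integrable leb f"
  using L2_mult_continuous_integrable[of f "\<lambda>x. 1"] by simp

lemma L2_diff:
  assumes "f \<in> L2" "g \<in> L2"
  shows "(\<lambda>x. f x - g x) \<in> L2"
proof -
  have [measurable]: "f \<in> borel_measurable leb" "g \<in> borel_measurable leb"
    using assms by (auto simp: L2_def)
  have "integrable leb (\<lambda>x. (f x - g x)\<^sup>2)"
  proof (rule Bochner_Integration.integrable_bound)
    show "integrable leb (\<lambda>x. 2 * (f x)\<^sup>2 + 2 * (g x)\<^sup>2)"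
      using assms by (auto simp: L2_def)
    have "(a - b)\<^sup>2 \<le> 2 * a\<^sup>2 + 2 * b\<^sup>2" for a b :: real
      using zero_le_power2[of "a + b"] by (simp add: power2_eq_square algebra_simps)
    then show "AE x in leb. norm ((f x - g x)\<^sup>2) \<le> norm (2 * (f x)\<^sup>2 + 2 * (g x)\<^sup>2)" by simp
  qed measurable
  then show ?thesis by (simp add: L2_def)
qed

text \<open>The fundamental lemma of the calculus of variations. Testing with bumps and passing to the limit
  by dominated convergence gives $\int_I h = 0$ for every open interval $I$. The Borel sets $A$ with
  $\int_A h = 0$ form a Dynkin system, and the open intervals are an intersection-stable generator,
  so the integral vanishes over every Borel set.\<close>

lemma AE_zero_if_orthogonal_to_test_functions:
  assumes h: "h \<in> L2" and zero: "\<And>\<eta>. \<eta> \<in> test_functions \<Longrightarrow> (LINT x|leb. h x * \<eta> x) = 0"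
  shows "AE x in leb. h x = 0"
proof -
  have ih: "integrable leb h" by (rule L2_integrable[OF h])
  then have "integrable lebesgue (\<lambda>x. indicator {0<..<pi} x * h x)"
    by (simp add: integrable_restrict_space)
  \<comment> \<open>Intervals generate the Borel sets but not the Lebesgue sets, hence a Borel representative.\<close>
  then obtain f where f: "f \<in> borel_measurable lborel"
      and fh: "AE x in lborel. indicator {0<..<pi} x * h x = f x"
    using completion_ex_borel_measurable_real[of "\<lambda>x. indicator {0<..<pi} x * h x" lborel] by auto
  have fh': "AE x in lebesgue. indicator {0<..<pi} x * h x = f x"
    using fh by (rule AE_completion)
  have intf: "integrable lborel f"
    using \<open>integrable lebesgue _\<close> f integrable_cong_AE[OF _ _ fh']
    by (metis borel_measurable_integrable integrable_completion measurable_completion)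
  have interval: "(LINT x|lborel. indicator {a<..<b} x * f x) = 0" for a b
  proof -
    \<comment> \<open>The part of the interval inside $(0,\pi)$, so that bumps on it are test functions.\<close>
    define a' b' where "a' = max a 0" and "b' = min b pi"
    have "(\<lambda>k. LINT x|leb. h x * bump a' b' k x) \<longlonglongrightarrow> (LINT x|leb. h x * indicator {a'<..<b'} x)"
    proof (rule integral_dominated_convergence[of _ _ _ "\<lambda>x. \<bar>h x\<bar>"])
      show "AE x in leb. (\<lambda>k. h x * bump a' b' k x) \<longlonglongrightarrow> h x * indicator {a'<..<b'} x"
        by (intro AE_I2 tendsto_intros bump_tendsto)
      show "AE x in leb. norm (h x * bump a' b' k x) \<le> \<bar>h x\<bar>" for k
        using mult_left_mono[OF bump_bound abs_ge_zero] by (auto simp: abs_mult)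
      have [measurable]: "h \<in> borel_measurable leb" using h by (simp add: L2_def)
      show "(\<lambda>x. h x * bump a' b' k x) \<in> borel_measurable leb" for k
      proof -
        have "bump a' b' k \<in> borel_measurable leb"
          by (intro continuous_measurable_leb test_functionD bump_test_function) (auto simp: a'_def b'_def)
        then show ?thesis by measurable
      qed
      have "indicator {a'<..<b'} \<in> borel_measurable leb"
        by (intro measurable_restrict_space1 borel_measurable_indicator) auto
      then show "(\<lambda>x. h x * indicator {a'<..<b'} x) \<in> borel_measurable leb" by measurable
      show "integrable leb (\<lambda>x. \<bar>h x\<bar>)" using ih by simp
    qed
    moreover have "(LINT x|leb. h x * bump a' b' k x) = 0" for k
      by (intro zero bump_test_function) (auto simp: a'_def b'_def)
    ultimately have lim: "(LINT x|leb. h x * indicator {a'<..<b'} x) = 0"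
      by (simp add: LIMSEQ_const_iff)
    have "(LINT x|leb. h x * indicator {a'<..<b'} x)
        = (LINT x|lebesgue. indicator {a<..<b} x * (indicator {0<..<pi} x * h x))"
      unfolding a'_def b'_def
      by (subst integral_restrict_space) (auto intro!: Bochner_Integration.integral_cong split: split_indicator)
    also have "\<dots> = (LINT x|lebesgue. indicator {a<..<b} x * f x)"
    proof (rule integral_cong_AE)
      have "(\<lambda>x. indicator {0<..<pi} x * h x) \<in> borel_measurable lebesgue"
        using \<open>integrable lebesgue _\<close> by (rule borel_measurable_integrable)
      then show "(\<lambda>x. indicator {a<..<b} x * (indicator {0<..<pi} x * h x)) \<in> borel_measurable lebesgue"
        by (rule borel_measurable_times[rotated]) (rule borel_measurable_indicator, simp)
      show "(\<lambda>x. indicator {a<..<b} x * f x) \<in> borel_measurable lebesgue"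
        using f by (intro borel_measurable_times borel_measurable_indicator) (auto intro: measurable_completion)
    qed (use fh' in eventually_elim, simp)
    also have "\<dots> = (LINT x|lborel. indicator {a<..<b} x * f x)"
      using f by (intro integral_completion) auto
    finally show ?thesis using lim by simp
  qed
  have ind: "integrable lborel (\<lambda>x. indicator A x * f x)" if "A \<in> sets borel" for A
    using integrable_mult_indicator[OF _ intf, of A] that by simp
  \<comment> \<open>The extension of \<open>h\<close> by zero lives on $(0,\pi)$, which lies in the interval $(-1,4)$.\<close>
  have whole: "(LINT x|lborel. f x) = 0"
  proof -
    have "(LINT x|lborel. indicator {-1<..<4} x * f x) = (LINT x|lborel. f x)"
    proof (rule integral_cong_AE)
      show "AE x in lborel. indicator {-1<..<4} x * f x = f x"
        using fh by eventually_elim (use pi_less_4 in \<open>auto split: split_indicator_asm split: split_indicator\<close>)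
    qed (use f in \<open>auto intro!: borel_measurable_times\<close>)
    then show ?thesis using interval by simp
  qed
  have "(LINT x|lborel. indicator A x * f x) = 0" if A: "A \<in> sets borel" for A
  proof -
    have bs: "sets borel = sigma_sets UNIV (range (\<lambda>(a::real, b). {a<..<b}))"
      by (subst borel_eq_box) (simp add: sets_measure_of split_def)
    have "{a<..<b} \<inter> {c<..<d} = {max a c<..<min b d}" for a b c d :: real
      by auto
    then have "Int_stable (range (\<lambda>(a::real, b). {a<..<b}))"
      by (auto simp: Int_stable_def)
    from this _ A[unfolded bs] show ?thesis
    proof (rule sigma_sets_induct_disjoint)
      show "(LINT x|lborel. indicator (UNIV - A) x * f x) = 0"
        if "A \<in> sigma_sets UNIV (range (\<lambda>(a::real, b). {a<..<b}))" "(LINT x|lborel. indicator A x * f x) = 0" for A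
      proof -
        have "(LINT x|lborel. indicator (UNIV - A) x * f x) = (LINT x|lborel. f x - indicator A x * f x)"
          by (intro Bochner_Integration.integral_cong) (auto split: split_indicator)
        also have "\<dots> = 0" using ind[of A] intf that whole unfolding bs by simp
        finally show ?thesis .
      qed
      show "(LINT x|lborel. indicator (\<Union>i. A i) x * f x) = 0"
        if "disjoint_family A" "range A \<subseteq> sigma_sets UNIV (range (\<lambda>(a::real, b). {a<..<b}))"
          "\<And>i::nat. (LINT x|lborel. indicator (A i) x * f x) = 0" for A
      proof -
        have A: "A i \<in> sets borel" for i using that(2) bs by auto
        have "set_integrable lborel (\<Union>i. A i) f"
          using ind[OF sets.countable_UN[of A UNIV borel]] A by (auto simp: set_integrable_def)
        then have "set_lebesgue_integral lborel (\<Union>i. A i) f = (\<Sum>i. set_lebesgue_integral lborel (A i) f)"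
          using A that(1) by (intro lebesgue_integral_countable_add) (auto simp: disjoint_family_on_def)
        then show ?thesis using that by (simp add: set_lebesgue_integral_def)
      qed
    qed (use interval in auto)
  qed
  then have "AE x in lborel. f x = 0"
    using density_unique_real[OF intf, of "\<lambda>x. 0"] by (simp add: set_lebesgue_integral_def)
  then have "AE x in lebesgue. f x = 0" by (rule AE_completion)
  with fh' have "AE x in lebesgue. x \<in> {0<..<pi} \<longrightarrow> h x = 0"
    by eventually_elim auto
  then show ?thesis by (subst AE_restrict_space_iff) auto
qed

section \<open>Weak derivatives of smooth functions\<close>

lemma weak_deriv_unique:
  assumes "g1 \<in> L2" "g2 \<in> L2" "has_weak_deriv f g1" "has_weak_deriv f g2"
  shows "AE x in leb. g1 x = g2 x"
proof -
  have "AE x in leb. g1 x - g2 x = 0"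
  proof (rule AE_zero_if_orthogonal_to_test_functions)
    show "(\<lambda>x. g1 x - g2 x) \<in> L2" by (intro L2_diff assms)
    fix \<eta> assume \<eta>: "\<eta> \<in> test_functions"
    have "integrable leb (\<lambda>x. g1 x * \<eta> x)" "integrable leb (\<lambda>x. g2 x * \<eta> x)"
      by (intro L2_mult_continuous_integrable assms test_functionD[OF \<eta>])+
    then show "(LINT x|leb. (g1 x - g2 x) * \<eta> x) = 0"
      using assms(3,4) \<eta> by (simp add: left_diff_distrib has_weak_deriv_def)
  qed
  then show ?thesis by simp
qed

text \<open>By uniqueness, whichever representative \<open>wderiv\<close> selects agrees almost everywhere with the
  classical derivative. Asking for \<open>f = g\<close> only almost everywhere makes the lemma applicable to
  a selected derivative in turn, and so yields second derivatives.\<close>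

lemma wderiv_AE_C1:
  assumes f: "f \<in> L2" "AE x in leb. f x = g x"
    and g: "\<And>x. (g has_real_derivative g' x) (at x)" "continuous_on UNIV g'"
  shows "f \<in> H1" "wderiv f \<in> L2" "AE x in leb. wderiv f x = g' x"
proof -
  have cg: "continuous_on UNIV g"
    using g(1) DERIV_isCont by (blast intro: continuous_at_imp_continuous_on)
  have L2: "g' \<in> L2" by (rule continuous_L2[OF g(2)])
  have "has_weak_deriv f g'"
    unfolding has_weak_deriv_def
  proof
    fix \<eta> assume \<eta>: "\<eta> \<in> test_functions"
    have [measurable]: "f \<in> borel_measurable leb" "g \<in> borel_measurable leb" "deriv \<eta> \<in> borel_measurable leb"
      using f(1) continuous_measurable_leb[OF cg] continuous_measurable_leb[OF test_functionD(2)[OF \<eta>]]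
      by (auto simp: L2_def)
    have "(LINT x|leb. f x * deriv \<eta> x) = (LINT x|leb. g x * deriv \<eta> x)"
    proof (rule integral_cong_AE)
      show "AE x in leb. f x * deriv \<eta> x = g x * deriv \<eta> x"
        using f(2) by eventually_elim simp
    qed measurable
    then show "(LINT x|leb. f x * deriv \<eta> x) = - (LINT x|leb. g' x * \<eta> x)"
      using C1_has_weak_deriv[OF g] \<eta> by (simp add: has_weak_deriv_def)
  qed
  then have ex: "g' \<in> L2 \<and> has_weak_deriv f g'" using L2 by simp
  then show "f \<in> H1" using f(1) by (auto simp: H1_def)
  have w: "wderiv f \<in> L2 \<and> has_weak_deriv f (wderiv f)"
    unfolding wderiv_def by (rule someI[of _ g']) (rule ex)
  then show "wderiv f \<in> L2" by simp
  show "AE x in leb. wderiv f x = g' x"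
    using w ex weak_deriv_unique by blast
qed

lemmas wderiv_C1 = wderiv_AE_C1[OF continuous_L2 AE_I2[OF refl]]

lemma H2_C2:
  assumes "\<And>x. (g has_real_derivative g' x) (at x)" "\<And>x. (g' has_real_derivative g'' x) (at x)"
    "continuous_on UNIV g''"
  shows "g \<in> H2" "AE x in leb. wderiv (wderiv g) x = g'' x"
proof -
  have "continuous_on UNIV g" "continuous_on UNIV g'"
    using assms(1,2) DERIV_isCont by (blast intro: continuous_at_imp_continuous_on)+
  note 1 = wderiv_C1[OF this(1) assms(1) this(2)]
  note 2 = wderiv_AE_C1[OF 1(2,3) assms(2,3)]
  show "g \<in> H2" using 1(1) 2(1) by (simp add: H2_def)
  show "AE x in leb. wderiv (wderiv g) x = g'' x" by (rule 2(3))
qed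

section \<open>Fourier modes in the function spaces\<close>

text \<open>The boundary conditions are met by $a \sin nx$ for $u$ and $a \cos nx$ for $\varphi$ and $\psi$;
  for $n \ge 1$ the cosine also has mean zero. Differentiation in $x$ exchanges the two families.\<close>

definition sin_mode :: "nat \<Rightarrow> real \<Rightarrow> real \<Rightarrow> real" where
  "sin_mode n a = (\<lambda>x. a * sin (n * x))"

definition cos_mode :: "nat \<Rightarrow> real \<Rightarrow> real \<Rightarrow> real" where
  "cos_mode n a = (\<lambda>x. a * cos (n * x))"

lemma mode_derivs:
  "(sin_mode n a has_real_derivative cos_mode n (n * a) x) (at x)"
  "(cos_mode n a has_real_derivative sin_mode n (- (n * a)) x) (at x)"
  unfolding sin_mode_def cos_mode_def by (auto intro!: derivative_eq_intros)

lemma mode_continuous: "continuous_on UNIV (sin_mode n a)" "continuous_on UNIV (cos_mode n a)"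
  unfolding sin_mode_def cos_mode_def by (intro continuous_intros)+

lemmas mode_L2 = mode_continuous[THEN continuous_L2]

lemmas wderiv_sin_mode = wderiv_C1[OF mode_continuous(1) mode_derivs(1) mode_continuous(2)]
lemmas wderiv_cos_mode = wderiv_C1[OF mode_continuous(2) mode_derivs(2) mode_continuous(1)]

lemmas H2_sin_mode = H2_C2[OF mode_derivs mode_continuous(1)]
lemmas H2_cos_mode = H2_C2[OF mode_derivs(2,1) mode_continuous(2)]

lemma sin_mode_ends: "sin_mode n a 0 = 0" "sin_mode n a pi = 0"
  by (simp_all add: sin_mode_def sin_npi)

lemma sin_mode_H1_0: "sin_mode n a \<in> H1_0"
  unfolding H1_0_def using wderiv_sin_mode(1) sin_mode_ends continuous_on_subset[OF mode_continuous(1)]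
  by (auto intro!: exI[of _ "sin_mode n a"])

lemma wderiv_cos_mode_H1_0: "wderiv (cos_mode n a) \<in> H1_0"
proof -
  have "wderiv (cos_mode n a) \<in> H1" using H2_cos_mode(1) by (simp add: H2_def)
  then show ?thesis
    unfolding H1_0_def using wderiv_cos_mode(3)[of n a] sin_mode_ends continuous_on_subset[OF mode_continuous(1)]
    by (auto intro!: exI[of _ "sin_mode n (- (n * a))"])
qed

lemma cos_mode_mean:
  assumes "n > 0" shows "(LINT x|leb. cos_mode n a x) = 0"
proof -
  have "(sin_mode n (a / n) has_real_derivative cos_mode n a x) (at x)" for x
    using mode_derivs(1)[of n "a / n" x] assms by simp
  from LINT_leb_FTC[OF this mode_continuous(2)] show ?thesis by (simp add: sin_mode_ends)
qed

lemma cos_mode_star: "n > 0 \<Longrightarrow> cos_mode n a \<in> H1_star" "n > 0 \<Longrightarrow> cos_mode n a \<in> L2_star"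
  by (simp_all add: H1_star_def L2_star_def wderiv_cos_mode(1) cos_mode_mean mode_L2)

lemma integral_mode_products:
  assumes "n > 0"
  shows "(LINT x|leb. (sin (real n * x))\<^sup>2) = pi / 2" "(LINT x|leb. (cos (real n * x))\<^sup>2) = pi / 2"
proof -
  have d: "((\<lambda>x. x / 2 - sin (n * x) * cos (n * x) / (2 * n)) has_real_derivative (sin (real n * x))\<^sup>2) (at x)"
       "((\<lambda>x. x / 2 + sin (n * x) * cos (n * x) / (2 * n)) has_real_derivative (cos (real n * x))\<^sup>2) (at x)" for x
  proof -
    have c: "cos (n * x) * cos (n * x) = 1 - sin (n * x) * sin (n * x)"
      using sin_cos_squared_add[of "n * x"] unfolding power2_eq_square by linarith
    have p: "((\<lambda>x. sin (n * x) * cos (n * x) / (2 * n)) has_real_derivative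
        (cos (n * x) * cos (n * x) - sin (n * x) * sin (n * x)) / 2) (at x)"
      using assms by (auto intro!: derivative_eq_intros simp: field_simps)
    have i: "((\<lambda>x. x / 2) has_real_derivative 1 / 2) (at x)" by (auto intro!: derivative_eq_intros)
    show "((\<lambda>x. x / 2 - sin (n * x) * cos (n * x) / (2 * n)) has_real_derivative (sin (real n * x))\<^sup>2) (at x)"
      by (rule DERIV_cong[OF DERIV_diff[OF i p]]) (simp add: c power2_eq_square field_simps)
    show "((\<lambda>x. x / 2 + sin (n * x) * cos (n * x) / (2 * n)) has_real_derivative (cos (real n * x))\<^sup>2) (at x)"
      by (rule DERIV_cong[OF DERIV_add[OF i p]]) (simp add: c power2_eq_square field_simps)
  qed
  show "(LINT x|leb. (sin (real n * x))\<^sup>2) = pi / 2"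
    by (subst LINT_leb_FTC[OF d(1)]) (auto intro!: continuous_intros simp: sin_npi)
  show "(LINT x|leb. (cos (real n * x))\<^sup>2) = pi / 2"
    by (subst LINT_leb_FTC[OF d(2)]) (auto intro!: continuous_intros simp: sin_npi)
qed

lemma norm_L2_mode:
  "norm_L2 (sin_mode n c) = \<bar>c\<bar> * norm_L2 (sin_mode n 1)"
  "norm_L2 (cos_mode n c) = \<bar>c\<bar> * norm_L2 (cos_mode n 1)"
  by (simp_all add: norm_L2_def sin_mode_def cos_mode_def power_mult_distrib real_sqrt_mult)

lemma norm_H1_C1:
  assumes "\<And>x. (g has_real_derivative g' x) (at x)" "continuous_on UNIV g" "continuous_on UNIV g'"
  shows "norm_H1 g = sqrt (LINT x|leb. (g x)\<^sup>2 + (g' x)\<^sup>2)"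
proof -
  note w = wderiv_C1[OF assms(2,1,3)]
  have [measurable]: "wderiv g \<in> borel_measurable leb" using w(2) by (simp add: L2_def)
  note [measurable] = assms(2,3)[THEN continuous_measurable_leb]
  have "(LINT x|leb. (g x)\<^sup>2 + (wderiv g x)\<^sup>2) = (LINT x|leb. (g x)\<^sup>2 + (g' x)\<^sup>2)"
  proof (rule integral_cong_AE)
    show "AE x in leb. (g x)\<^sup>2 + (wderiv g x)\<^sup>2 = (g x)\<^sup>2 + (g' x)\<^sup>2"
      using w(3) by eventually_elim simp
  qed measurable
  then show ?thesis by (simp add: norm_H1_def)
qed

lemma norm_H1_mode:
  "norm_H1 (sin_mode n c) = \<bar>c\<bar> * norm_H1 (sin_mode n 1)"
  "norm_H1 (cos_mode n c) = \<bar>c\<bar> * norm_H1 (cos_mode n 1)"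
proof -
  have eq: "(sin_mode n c x)\<^sup>2 + (cos_mode n (n * c) x)\<^sup>2 = c\<^sup>2 * ((sin_mode n 1 x)\<^sup>2 + (cos_mode n (real n * 1) x)\<^sup>2)"
     "(cos_mode n c x)\<^sup>2 + (sin_mode n (- (n * c)) x)\<^sup>2 = c\<^sup>2 * ((cos_mode n 1 x)\<^sup>2 + (sin_mode n (- (real n * 1)) x)\<^sup>2)" for x
    by (simp_all add: sin_mode_def cos_mode_def power_mult_distrib algebra_simps)
  show "norm_H1 (sin_mode n c) = \<bar>c\<bar> * norm_H1 (sin_mode n 1)"
    unfolding norm_H1_C1[OF mode_derivs(1) mode_continuous] eq
    by (simp only: integral_mult_right_zero real_sqrt_mult real_sqrt_abs)
  show "norm_H1 (cos_mode n c) = \<bar>c\<bar> * norm_H1 (cos_mode n 1)"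
    unfolding norm_H1_C1[OF mode_derivs(2) mode_continuous(2,1)] eq
    by (simp only: integral_mult_right_zero real_sqrt_mult real_sqrt_abs)
qed

text \<open>Along a fixed mode every seminorm is a multiple of the absolute value of the amplitude, so
  continuity and differentiability in the function space reduce to those of the real amplitude.\<close>

lemma mode_continuous_in:
  assumes m: "\<And>a b x. m (a - b) x = m a x - m b x" and N: "\<And>c. N (m c) = \<bar>c\<bar> * K"
    and c: "continuous_on {0..} c"
  shows "continuous_in N (\<lambda>t. m (c t))"
  unfolding continuous_in_def
proof (intro allI impI)
  fix t :: real assume "t \<ge> 0"
  then have "((\<lambda>s. c s) \<longlongrightarrow> c t) (at t within {0..})"
    using c by (auto simp: continuous_on_def)
  then have "((\<lambda>s. \<bar>c s - c t\<bar> * K) \<longlongrightarrow> \<bar>c t - c t\<bar> * K) (at t within {0..})"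
    by (intro tendsto_intros)
  then show "((\<lambda>s. N (\<lambda>x. m (c s) x - m (c t) x)) \<longlongrightarrow> 0) (at t within {0..})"
    by (simp add: m[symmetric] N)
qed

lemma mode_primitive_in:
  assumes m: "\<And>a b x. m (a - b) x = m a x - m b x" "\<And>a b x. m (a / b) x = m a x / b"
    and N: "\<And>c. N (m c) = \<bar>c\<bar> * K"
    and c: "C 0 = 0" "\<And>t. (C has_real_derivative c t) (at t)"
  shows "primitive_in N (\<lambda>t. m (C t)) (\<lambda>t. m (c t))"
  unfolding primitive_in_def
proof (intro allI impI conjI)
  show "AE x in leb. m (C 0) x = 0" using m(1)[of 0 0] c(1) by simp
  fix t :: real assume "t \<ge> 0"
  have "((\<lambda>s. (C s - C t) / (s - t)) \<longlongrightarrow> c t) (at t within {0..})"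
    using has_field_derivative_at_within[OF c(2), of t "{0..}"] by (simp add: has_field_derivative_iff)
  then have "((\<lambda>s. \<bar>(C s - C t) / (s - t) - c t\<bar> * K) \<longlongrightarrow> \<bar>c t - c t\<bar> * K) (at t within {0..})"
    by (intro tendsto_intros)
  then show "((\<lambda>s. N (\<lambda>x. (m (C s) x - m (C t) x) / (s - t) - m (c t) x)) \<longlongrightarrow> 0) (at t within {0..})"
    by (simp only: m[symmetric] N) simp
qed

section \<open>Solutions on a single mode\<close>

text \<open>On the mode \<open>n\<close> the system is a system of ordinary differential equations for the amplitudes
  \<open>p\<close>, \<open>q\<close>, \<open>r\<close> of $u$, $\varphi$, $\psi$. It enters in integrated form, with \<open>P\<close>, \<open>Q\<close>, \<open>R\<close> the
  antiderivatives of the amplitudes, because mild solutions are defined through the time integral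
  of the state.\<close>

lemma mode_semigroup_solution:
  fixes P Q R p q r p' q' r' :: "real \<Rightarrow> real"
  assumes n: "n > 0"
    and zero: "P 0 = 0" "Q 0 = 0" "R 0 = 0"
    and prim: "\<And>t. (P has_real_derivative p t) (at t)" "\<And>t. (Q has_real_derivative q t) (at t)"
      "\<And>t. (R has_real_derivative r t) (at t)"
    and deriv: "\<And>t. (p has_real_derivative p' t) (at t)" "\<And>t. (q has_real_derivative q' t) (at t)"
      "\<And>t. (r has_real_derivative r' t) (at t)"
    and cont: "continuous_on UNIV p'" "continuous_on UNIV q'" "continuous_on UNIV r'"
    and eqs: "\<And>t. \<rho> * (p' t - p' 0) = - (\<mu> * (real n)\<^sup>2) * P t - b * real n * Q t - d * real n * R t"
      "\<And>t. \<kappa>1 * (q' t - q' 0) = - (\<alpha> * (real n)\<^sup>2) * Q t - \<beta> * (real n)\<^sup>2 * R t - b * real n * P t - \<alpha>1 * Q t - \<alpha>3 * R t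
        - \<tau>1 * (q t - q 0) - \<tau>2 * (r t - r 0)"
      "\<And>t. \<kappa>2 * (r' t - r' 0) = - (\<beta> * (real n)\<^sup>2) * Q t - \<gamma> * (real n)\<^sup>2 * R t - d * real n * P t - \<alpha>3 * Q t - \<alpha>2 * R t
        - \<tau>3 * (q t - q 0) - \<tau>4 * (r t - r 0)"
  shows "semigroup_solution \<rho> \<kappa>1 \<kappa>2 \<mu> \<alpha> \<beta> \<gamma> \<alpha>1 \<alpha>2 \<alpha>3 b d \<tau>1 \<tau>2 \<tau>3 \<tau>4
    (\<lambda>t. sin_mode n (p t)) (\<lambda>t. sin_mode n (p' t)) (\<lambda>t. cos_mode n (q t)) (\<lambda>t. cos_mode n (q' t))
    (\<lambda>t. cos_mode n (r t)) (\<lambda>t. cos_mode n (r' t))"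
proof -
  have ms: "sin_mode n (a - b) x = sin_mode n a x - sin_mode n b x" "sin_mode n (a / b) x = sin_mode n a x / b"
     "cos_mode n (a - b) x = cos_mode n a x - cos_mode n b x" "cos_mode n (a / b) x = cos_mode n a x / b" for a b x
    by (simp_all add: sin_mode_def cos_mode_def algebra_simps)
  have cpqr: "continuous_on {0..} p" "continuous_on {0..} q" "continuous_on {0..} r"
    using deriv[THEN DERIV_isCont] by (auto intro!: continuous_at_imp_continuous_on)
  have cpqr': "continuous_on {0..} p'" "continuous_on {0..} q'" "continuous_on {0..} r'"
    using cont by (auto intro: continuous_on_subset)
  have deriv0: "((\<lambda>t. p t - p 0) has_real_derivative p' t) (at t)" "((\<lambda>t. q t - q 0) has_real_derivative q' t) (at t)"
    "((\<lambda>t. r t - r 0) has_real_derivative r' t) (at t)" for t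
    by (auto intro!: derivative_eq_intros deriv)
  note conts = mode_continuous_in[of "sin_mode n", OF ms(1)] mode_continuous_in[of "cos_mode n", OF ms(3)]
  note prims = mode_primitive_in[of "sin_mode n", OF ms(1,2)] mode_primitive_in[of "cos_mode n", OF ms(3,4)]
  have space: "(sin_mode n (p t), sin_mode n (p' t), cos_mode n (q t), cos_mode n (q' t), cos_mode n (r t), cos_mode n (r' t))
      \<in> energy_space" for t
    unfolding energy_space_def using n by (simp add: sin_mode_H1_0 mode_L2 cos_mode_star)
  have dom: "(sin_mode n (P t), sin_mode n (p t - p 0), cos_mode n (Q t), cos_mode n (q t - q 0), cos_mode n (R t),
      cos_mode n (r t - r 0)) \<in> generator_domain" for t
    unfolding generator_domain_def using n
    by (simp add: sin_mode_H1_0 cos_mode_star wderiv_cos_mode_H1_0 H2_sin_mode(1) H2_cos_mode(1))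
  have ae: "AE x in leb.
      sin_mode n (p t) x = sin_mode n (p 0) x + sin_mode n (p t - p 0) x \<and>
      \<rho> * sin_mode n (p' t) x = \<rho> * sin_mode n (p' 0) x + \<mu> * wderiv (wderiv (sin_mode n (P t))) x
        + b * wderiv (cos_mode n (Q t)) x + d * wderiv (cos_mode n (R t)) x \<and>
      cos_mode n (q t) x = cos_mode n (q 0) x + cos_mode n (q t - q 0) x \<and>
      \<kappa>1 * cos_mode n (q' t) x = \<kappa>1 * cos_mode n (q' 0) x + \<alpha> * wderiv (wderiv (cos_mode n (Q t))) x
        + \<beta> * wderiv (wderiv (cos_mode n (R t))) x - b * wderiv (sin_mode n (P t)) x
        - \<alpha>1 * cos_mode n (Q t) x - \<alpha>3 * cos_mode n (R t) x
        - \<tau>1 * cos_mode n (q t - q 0) x - \<tau>2 * cos_mode n (r t - r 0) x \<and>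
      cos_mode n (r t) x = cos_mode n (r 0) x + cos_mode n (r t - r 0) x \<and>
      \<kappa>2 * cos_mode n (r' t) x = \<kappa>2 * cos_mode n (r' 0) x + \<beta> * wderiv (wderiv (cos_mode n (Q t))) x
        + \<gamma> * wderiv (wderiv (cos_mode n (R t))) x - d * wderiv (sin_mode n (P t)) x
        - \<alpha>3 * cos_mode n (Q t) x - \<alpha>2 * cos_mode n (R t) x
        - \<tau>3 * cos_mode n (q t - q 0) x - \<tau>4 * cos_mode n (r t - r 0) x" for t
    using wderiv_sin_mode(3)[of n "P t"] wderiv_cos_mode(3)[of n "Q t"] wderiv_cos_mode(3)[of n "R t"]
      H2_sin_mode(2)[of n "P t"] H2_cos_mode(2)[of n "Q t"] H2_cos_mode(2)[of n "R t"]
  proof eventually_elim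
    case (elim x)
    have e: "\<rho> * (p' t - p' 0) * sin (n * x) = (- (\<mu> * (real n)\<^sup>2) * P t - b * real n * Q t - d * real n * R t) * sin (n * x)"
      "\<kappa>1 * (q' t - q' 0) * cos (n * x) = (- (\<alpha> * (real n)\<^sup>2) * Q t - \<beta> * (real n)\<^sup>2 * R t - b * real n * P t - \<alpha>1 * Q t - \<alpha>3 * R t
        - \<tau>1 * (q t - q 0) - \<tau>2 * (r t - r 0)) * cos (n * x)"
      "\<kappa>2 * (r' t - r' 0) * cos (n * x) = (- (\<beta> * (real n)\<^sup>2) * Q t - \<gamma> * (real n)\<^sup>2 * R t - d * real n * P t - \<alpha>3 * Q t - \<alpha>2 * R t
        - \<tau>3 * (q t - q 0) - \<tau>4 * (r t - r 0)) * cos (n * x)"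
      by (simp_all add: eqs)
    show ?case
      unfolding elim ms using e
      by (simp add: sin_mode_def cos_mode_def algebra_simps power2_eq_square)
  qed
  show ?thesis
    unfolding semigroup_solution_def
  proof (intro conjI allI impI)
    show "\<exists>U V \<Phi> W \<Psi> Z.
        primitive_in norm_H1 U (\<lambda>t. sin_mode n (p t)) \<and> primitive_in norm_L2 V (\<lambda>t. sin_mode n (p' t)) \<and>
        primitive_in norm_H1 \<Phi> (\<lambda>t. cos_mode n (q t)) \<and> primitive_in norm_L2 W (\<lambda>t. cos_mode n (q' t)) \<and>
        primitive_in norm_H1 \<Psi> (\<lambda>t. cos_mode n (r t)) \<and> primitive_in norm_L2 Z (\<lambda>t. cos_mode n (r' t)) \<and>
        (\<forall>t\<ge>0. (U t, V t, \<Phi> t, W t, \<Psi> t, Z t) \<in> generator_domain \<and>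
          (AE x in leb.
             sin_mode n (p t) x = sin_mode n (p 0) x + V t x \<and>
             \<rho> * sin_mode n (p' t) x = \<rho> * sin_mode n (p' 0) x + \<mu> * wderiv (wderiv (U t)) x
               + b * wderiv (\<Phi> t) x + d * wderiv (\<Psi> t) x \<and>
             cos_mode n (q t) x = cos_mode n (q 0) x + W t x \<and>
             \<kappa>1 * cos_mode n (q' t) x = \<kappa>1 * cos_mode n (q' 0) x + \<alpha> * wderiv (wderiv (\<Phi> t)) x
               + \<beta> * wderiv (wderiv (\<Psi> t)) x - b * wderiv (U t) x
               - \<alpha>1 * \<Phi> t x - \<alpha>3 * \<Psi> t x - \<tau>1 * W t x - \<tau>2 * Z t x \<and>
             cos_mode n (r t) x = cos_mode n (r 0) x + Z t x \<and>
             \<kappa>2 * cos_mode n (r' t) x = \<kappa>2 * cos_mode n (r' 0) x + \<beta> * wderiv (wderiv (\<Phi> t)) x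
               + \<gamma> * wderiv (wderiv (\<Psi> t)) x - d * wderiv (U t) x
               - \<alpha>3 * \<Phi> t x - \<alpha>2 * \<Psi> t x - \<tau>3 * W t x - \<tau>4 * Z t x))"
      by (rule exI[of _ "\<lambda>t. sin_mode n (P t)"], rule exI[of _ "\<lambda>t. sin_mode n (p t - p 0)"],
          rule exI[of _ "\<lambda>t. cos_mode n (Q t)"], rule exI[of _ "\<lambda>t. cos_mode n (q t - q 0)"],
          rule exI[of _ "\<lambda>t. cos_mode n (R t)"], rule exI[of _ "\<lambda>t. cos_mode n (r t - r 0)"])
        (intro conjI allI impI dom ae
          prims(1)[OF norm_H1_mode(1) zero(1) prim(1)] prims(1)[OF norm_L2_mode(1) _ deriv0(1)]
          prims(2)[OF norm_H1_mode(2) zero(2) prim(2)] prims(2)[OF norm_L2_mode(2) _ deriv0(2)]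
          prims(2)[OF norm_H1_mode(2) zero(3) prim(3)] prims(2)[OF norm_L2_mode(2) _ deriv0(3)], simp_all)
  qed (intro space conts(1)[OF norm_H1_mode(1) cpqr(1)] conts(1)[OF norm_L2_mode(1) cpqr'(1)]
    conts(2)[OF norm_H1_mode(2) cpqr(2)] conts(2)[OF norm_L2_mode(2) cpqr'(2)]
    conts(2)[OF norm_H1_mode(2) cpqr(3)] conts(2)[OF norm_L2_mode(2) cpqr'(3)])+
qed

section \<open>The energy of a mode\<close>

text \<open>The factor $\pi/4$ is the $1/2$ of the energy times $\int_0^\pi \sin^2 nx\,dx = \int_0^\pi \cos^2 nx\,dx
  = \pi/2$.\<close>

definition mode_energy ::
  "real \<Rightarrow> real \<Rightarrow> real \<Rightarrow> real \<Rightarrow> real \<Rightarrow> real \<Rightarrow> real \<Rightarrow> real \<Rightarrow> real \<Rightarrow> real \<Rightarrow> real \<Rightarrow> real \<Rightarrow> nat \<Rightarrow>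
   real \<Rightarrow> real \<Rightarrow> real \<Rightarrow> real \<Rightarrow> real \<Rightarrow> real \<Rightarrow> real" where
  "mode_energy \<rho> \<kappa>1 \<kappa>2 \<mu> \<alpha> \<beta> \<gamma> \<alpha>1 \<alpha>2 \<alpha>3 b d n p p' q q' r r' = pi / 4 *
     (\<rho> * p'\<^sup>2 + \<kappa>1 * q'\<^sup>2 + \<kappa>2 * r'\<^sup>2
      + (\<mu> * (n * p)\<^sup>2 + \<alpha>1 * q\<^sup>2 + \<alpha>2 * r\<^sup>2 + 2 * b * (n * p) * q + 2 * d * (n * p) * r + 2 * \<alpha>3 * q * r
      + \<alpha> * (n * q)\<^sup>2 + \<gamma> * (n * r)\<^sup>2 + 2 * \<beta> * (n * q) * (n * r)))"

lemma energy_mode: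
  assumes n: "n > 0"
  shows "energy \<rho> \<kappa>1 \<kappa>2 \<mu> \<alpha> \<beta> \<gamma> \<alpha>1 \<alpha>2 \<alpha>3 b d
     (sin_mode n p) (sin_mode n p') (cos_mode n q) (cos_mode n q') (cos_mode n r) (cos_mode n r') =
     mode_energy \<rho> \<kappa>1 \<kappa>2 \<mu> \<alpha> \<beta> \<gamma> \<alpha>1 \<alpha>2 \<alpha>3 b d n p p' q q' r r'"
proof -
  \<comment> \<open>\<open>X\<close> collects the coefficients of $\cos^2 nx$ and \<open>Y\<close> those of $\sin^2 nx$.\<close>
  define X where "X = \<kappa>1 * q'\<^sup>2 + \<kappa>2 * r'\<^sup>2 + \<mu> * (n * p)\<^sup>2 + \<alpha>1 * q\<^sup>2 + \<alpha>2 * r\<^sup>2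
     + 2 * b * (n * p) * q + 2 * d * (n * p) * r + 2 * \<alpha>3 * q * r"
  define Y where "Y = \<rho> * p'\<^sup>2 + \<alpha> * (n * q)\<^sup>2 + \<gamma> * (n * r)\<^sup>2 + 2 * \<beta> * (n * q) * (n * r)"
  let ?I = "\<lambda>u v \<phi> w \<psi> z ux \<phi>x \<psi>x x. \<rho> * (v x)\<^sup>2 + \<kappa>1 * (w x)\<^sup>2 + \<kappa>2 * (z x)\<^sup>2
       + \<mu> * (ux x)\<^sup>2 + \<alpha> * (\<phi>x x)\<^sup>2 + \<gamma> * (\<psi>x x)\<^sup>2
       + \<alpha>1 * (\<phi> x)\<^sup>2 + \<alpha>2 * (\<psi> x)\<^sup>2 + 2 * \<beta> * \<phi>x x * \<psi>x x
       + 2 * b * ux x * \<phi> x + 2 * d * ux x * \<psi> x + 2 * \<alpha>3 * \<phi> x * (\<psi> x :: real)"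
  have meas: "wderiv (sin_mode n p) \<in> borel_measurable leb" "wderiv (cos_mode n q) \<in> borel_measurable leb"
      "wderiv (cos_mode n r) \<in> borel_measurable leb"
    using wderiv_sin_mode(2) wderiv_cos_mode(2) by (simp_all add: L2_def)
  note meas2 = mode_continuous[THEN continuous_measurable_leb]
  have "(LINT x|leb. ?I (sin_mode n p) (sin_mode n p') (cos_mode n q) (cos_mode n q') (cos_mode n r) (cos_mode n r')
       (wderiv (sin_mode n p)) (wderiv (cos_mode n q)) (wderiv (cos_mode n r)) x)
     = (LINT x|leb. X * (cos (n * x))\<^sup>2 + Y * (sin (n * x))\<^sup>2)"
  proof (rule integral_cong_AE)
    note [measurable] = meas meas2
    show "?I (sin_mode n p) (sin_mode n p') (cos_mode n q) (cos_mode n q') (cos_mode n r) (cos_mode n r')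
       (wderiv (sin_mode n p)) (wderiv (cos_mode n q)) (wderiv (cos_mode n r)) \<in> borel_measurable leb"
      by measurable
    show "(\<lambda>x. X * (cos (n * x))\<^sup>2 + Y * (sin (n * x))\<^sup>2) \<in> borel_measurable leb"
      by (intro continuous_measurable_leb continuous_intros)
    show "AE x in leb. ?I (sin_mode n p) (sin_mode n p') (cos_mode n q) (cos_mode n q') (cos_mode n r) (cos_mode n r')
       (wderiv (sin_mode n p)) (wderiv (cos_mode n q)) (wderiv (cos_mode n r)) x
       = X * (cos (n * x))\<^sup>2 + Y * (sin (n * x))\<^sup>2"
      using wderiv_sin_mode(3)[of n p] wderiv_cos_mode(3)[of n q] wderiv_cos_mode(3)[of n r]
    proof eventually_elim
      case (elim x)
      show ?case unfolding elim unfolding X_def Y_def sin_mode_def cos_mode_def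
        by (simp add: algebra_simps power2_eq_square)
    qed
  qed
  also have "\<dots> = X * (LINT x|leb. (cos (n * x))\<^sup>2) + Y * (LINT x|leb. (sin (n * x))\<^sup>2)"
    by (subst Bochner_Integration.integral_add) (auto intro!: continuous_integrable_leb continuous_intros)
  also have "\<dots> = (X + Y) * (pi / 2)"
    by (simp only: integral_mode_products[OF n] distrib_right)
  finally show ?thesis
    unfolding energy_def mode_energy_def X_def Y_def by (simp add: algebra_simps)
qed

lemma mode_energy_scale:
  "mode_energy \<rho> \<kappa>1 \<kappa>2 \<mu> \<alpha> \<beta> \<gamma> \<alpha>1 \<alpha>2 \<alpha>3 b d n (s * p) (s * p') (s * q) (s * q') (s * r) (s * r')
   = s\<^sup>2 * mode_energy \<rho> \<kappa>1 \<kappa>2 \<mu> \<alpha> \<beta> \<gamma> \<alpha>1 \<alpha>2 \<alpha>3 b d n p p' q q' r r'"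
  unfolding mode_energy_def by (simp add: algebra_simps power2_eq_square)

lemma exhaust_5: "x = 1 \<or> x = 2 \<or> x = 3 \<or> x = 4 \<or> x = 5" for x :: 5
proof (induct x)
  case (of_int z)
  then have "z = 0 \<or> z = 1 \<or> z = 2 \<or> z = 3 \<or> z = 4" by fastforce
  then show ?case by auto
qed

lemma UNIV_5: "UNIV = {1, 2, 3, 4, 5 :: 5}"
  using exhaust_5 by auto

lemma sum_5: "sum f (UNIV :: 5 set) = f 1 + f 2 + f 3 + f 4 + f 5"
  unfolding UNIV_5 by (simp add: ac_simps)

lemma vector_5:
  "(vector [x1, x2, x3, x4, x5] :: ('a::zero)^5) $ 1 = x1"
  "(vector [x1, x2, x3, x4, x5] :: ('a::zero)^5) $ 2 = x2"
  "(vector [x1, x2, x3, x4, x5] :: ('a::zero)^5) $ 3 = x3"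
  "(vector [x1, x2, x3, x4, x5] :: ('a::zero)^5) $ 4 = x4"
  "(vector [x1, x2, x3, x4, x5] :: ('a::zero)^5) $ 5 = x5"
  unfolding vector_def by simp_all

lemma potential_energy_pos:
  assumes "positive_definite (coefficient_matrix \<mu> \<alpha> \<beta> \<gamma> \<alpha>1 \<alpha>2 \<alpha>3 b d)"
    and nz: "\<not> (y1 = 0 \<and> y2 = 0 \<and> y3 = 0 \<and> y4 = 0 \<and> y5 = 0)"
  shows "\<mu> * y1\<^sup>2 + \<alpha>1 * y2\<^sup>2 + \<alpha>2 * y3\<^sup>2 + 2 * b * y1 * y2 + 2 * d * y1 * y3 + 2 * \<alpha>3 * y2 * y3
     + \<alpha> * y4\<^sup>2 + \<gamma> * y5\<^sup>2 + 2 * \<beta> * y4 * y5 > 0"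
proof -
  let ?y = "vector [y1, y2, y3, y4, y5] :: real^5"
  have "?y \<noteq> 0" using nz vector_5[of y1 y2 y3 y4 y5] by (metis zero_index)
  then have "0 < ?y \<bullet> (coefficient_matrix \<mu> \<alpha> \<beta> \<gamma> \<alpha>1 \<alpha>2 \<alpha>3 b d *v ?y)"
    using assms(1) by (auto simp: positive_definite_def)
  then show ?thesis
    by (simp add: inner_vec_def matrix_vector_mult_def sum_5 coefficient_matrix_def vector_5
      algebra_simps power2_eq_square)
qed

text \<open>The potential part is the quadratic form of the coefficient matrix at the vector
  $(np, q, r, nq, nr)$.\<close>

lemma mode_energy_pos:
  assumes "\<rho> > 0" "\<kappa>1 > 0" "\<kappa>2 > 0"
    and pd: "positive_definite (coefficient_matrix \<mu> \<alpha> \<beta> \<gamma> \<alpha>1 \<alpha>2 \<alpha>3 b d)"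
    and n: "n > 0" and nz: "\<not> (p = 0 \<and> q = 0 \<and> r = 0 \<and> p' = 0 \<and> q' = 0 \<and> r' = 0)"
  shows "mode_energy \<rho> \<kappa>1 \<kappa>2 \<mu> \<alpha> \<beta> \<gamma> \<alpha>1 \<alpha>2 \<alpha>3 b d n p p' q q' r r' > 0"
proof -
  let ?V = "\<mu> * (n * p)\<^sup>2 + \<alpha>1 * q\<^sup>2 + \<alpha>2 * r\<^sup>2 + 2 * b * (n * p) * q + 2 * d * (n * p) * r + 2 * \<alpha>3 * q * r
      + \<alpha> * (n * q)\<^sup>2 + \<gamma> * (n * r)\<^sup>2 + 2 * \<beta> * (n * q) * (n * r)"
  have kin: "\<rho> * p'\<^sup>2 \<ge> 0" "\<kappa>1 * q'\<^sup>2 \<ge> 0" "\<kappa>2 * r'\<^sup>2 \<ge> 0" using assms by simp_all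
  have "\<rho> * p'\<^sup>2 + \<kappa>1 * q'\<^sup>2 + \<kappa>2 * r'\<^sup>2 + ?V > 0"
  proof (cases "p = 0 \<and> q = 0 \<and> r = 0")
    case True
    then have "\<rho> * p'\<^sup>2 > 0 \<or> \<kappa>1 * q'\<^sup>2 > 0 \<or> \<kappa>2 * r'\<^sup>2 > 0" using nz assms by auto
    then show ?thesis using kin True by auto
  next
    case False
    then have "?V > 0" using n by (intro potential_energy_pos[OF pd]) auto
    then show ?thesis using kin by linarith
  qed
  then show ?thesis unfolding mode_energy_def by simp
qed

section \<open>Locating roots of polynomials\<close>

text \<open>If $p$ has the roots $z_1, \dots, z_m$, then $p'(z_0)/p(z_0) = \sum_j 1/(z_0 - z_j)$, and every summand
  is at most $1/r$ in modulus. The induction splits off one root at a time. Read contrapositively,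
  this locates a root of $p$ within distance $m\,|p(z_0)|/|p'(z_0)|$ of $z_0$.\<close>

lemma pderiv_bound_if_no_root_near:
  fixes p :: "complex poly"
  assumes "r > 0" "\<And>z. poly p z = 0 \<Longrightarrow> r \<le> norm (z0 - z)"
  shows "r * norm (poly (pderiv p) z0) \<le> degree p * norm (poly p z0)"
  using assms(2)
proof (induction "degree p" arbitrary: p)
  case 0
  then have "pderiv p = 0" by (simp add: pderiv_eq_0_iff)
  then show ?case by simp
next
  case (Suc k)
  then have "\<not> constant (poly p)" using constant_degree[of p] by simp
  then obtain a where a: "poly p a = 0" using fundamental_theorem_of_algebra by blast
  then obtain q where q: "p = [:- a, 1:] * q" by (auto simp: poly_eq_0_iff_dvd dvd_def)
  have "p \<noteq> 0" using Suc.hyps(2) by auto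
  then have deg: "degree p = Suc (degree q)" unfolding q by (subst degree_mult_eq) auto
  have IH: "r * norm (poly (pderiv q) z0) \<le> degree q * norm (poly q z0)"
    by (rule Suc.hyps(1)) (use Suc deg q in auto)
  have ra: "r \<le> norm (z0 - a)" using Suc.prems a by blast
  have "r * norm (poly (pderiv p) z0) \<le> r * (norm (poly q z0) + norm (z0 - a) * norm (poly (pderiv q) z0))"
  proof (rule mult_left_mono)
    have "poly (pderiv p) z0 = poly q z0 + (z0 - a) * poly (pderiv q) z0"
      unfolding q pderiv_mult by (simp add: pderiv_pCons algebra_simps)
    then show "norm (poly (pderiv p) z0) \<le> norm (poly q z0) + norm (z0 - a) * norm (poly (pderiv q) z0)"
      using norm_triangle_ineq[of "poly q z0" "(z0 - a) * poly (pderiv q) z0"] by (simp add: norm_mult)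
  qed (use assms(1) in simp)
  also have "\<dots> = r * norm (poly q z0) + norm (z0 - a) * (r * norm (poly (pderiv q) z0))"
    by (simp add: algebra_simps)
  also have "\<dots> \<le> norm (z0 - a) * norm (poly q z0) + norm (z0 - a) * (degree q * norm (poly q z0))"
    by (intro add_mono mult_right_mono mult_left_mono ra IH) auto
  also have "\<dots> = degree p * norm (poly p z0)"
  proof -
    have "poly p z0 = (z0 - a) * poly q z0" unfolding q by (simp add: algebra_simps)
    then show ?thesis unfolding deg by (simp only: norm_mult) (simp add: algebra_simps)
  qed
  finally show ?case .
qed

section \<open>The dispersion polynomial near the wave frequencies\<close>

text \<open>Substituting $u = A e^{\lambda t} \sin nx$, $\varphi = B e^{\lambda t} \cos nx$,
  $\psi = C e^{\lambda t} \cos nx$ turns the system into a homogeneous $3 \times 3$ linear system for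
  $(A, B, C)$. The following is its determinant as a polynomial in $\lambda$.\<close>

definition dispersion ::
  "real \<Rightarrow> real \<Rightarrow> real \<Rightarrow> real \<Rightarrow> real \<Rightarrow> real \<Rightarrow> real \<Rightarrow> real \<Rightarrow> real \<Rightarrow> real \<Rightarrow> real \<Rightarrow> real \<Rightarrow>
   real \<Rightarrow> real \<Rightarrow> real \<Rightarrow> real \<Rightarrow> nat \<Rightarrow> complex poly" where
  "dispersion \<rho> \<kappa>1 \<kappa>2 \<mu> \<alpha> \<beta> \<gamma> \<alpha>1 \<alpha>2 \<alpha>3 b d \<tau>1 \<tau>2 \<tau>3 \<tau>4 n =
    (let N = of_nat n;
         p = [:of_real \<alpha> * N\<^sup>2 + of_real \<alpha>1, of_real \<tau>1, of_real \<kappa>1:];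
         q = [:of_real \<beta> * N\<^sup>2 + of_real \<alpha>3, of_real \<tau>2:];
         s = [:of_real \<beta> * N\<^sup>2 + of_real \<alpha>3, of_real \<tau>3:];
         r = [:of_real \<gamma> * N\<^sup>2 + of_real \<alpha>2, of_real \<tau>4, of_real \<kappa>2:]
     in [:of_real \<mu> * N\<^sup>2, 0, of_real \<rho>:] * (p * r - q * s)
        - smult (N\<^sup>2) (smult (of_real (b\<^sup>2)) r + smult (of_real (d\<^sup>2)) p - smult (of_real (b * d)) (q + s)))"

lemma degree_dispersion: "degree (dispersion \<rho> \<kappa>1 \<kappa>2 \<mu> \<alpha> \<beta> \<gamma> \<alpha>1 \<alpha>2 \<alpha>3 b d \<tau>1 \<tau>2 \<tau>3 \<tau>4 n) \<le> 6"
proof -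
  have 2: "degree [:x, y, z:] \<le> 2" for x y z :: complex by simp
  have 1: "degree [:x, y:] \<le> 1" for x y :: complex by simp
  have m: "degree (p * q) \<le> k" if "degree p \<le> i" "degree q \<le> j" "i + j \<le> k" for p q :: "complex poly" and i j k
    using degree_mult_le[of p q] that by linarith
  show ?thesis unfolding dispersion_def Let_def
    by (rule degree_diff_le[OF m[OF 2 degree_diff_le[OF m[OF 2 2] m[OF 1 1]]]])
       (auto intro!: degree_add_le degree_diff_le order_trans[OF degree_smult_le])
qed

lemma dispersion_kernel:
  fixes \<rho> \<kappa>1 \<kappa>2 \<mu> \<alpha> \<beta> \<gamma> \<alpha>1 \<alpha>2 \<alpha>3 b d \<tau>1 \<tau>2 \<tau>3 \<tau>4 :: real and n :: nat and l :: complex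
  assumes "poly (dispersion \<rho> \<kappa>1 \<kappa>2 \<mu> \<alpha> \<beta> \<gamma> \<alpha>1 \<alpha>2 \<alpha>3 b d \<tau>1 \<tau>2 \<tau>3 \<tau>4 n) l = 0"
  obtains A B C :: complex where "\<not> (A = 0 \<and> B = 0 \<and> C = 0)"
    "\<rho> * l\<^sup>2 * A = - (\<mu> * (real n)\<^sup>2) * A - b * real n * B - d * real n * C"
    "\<kappa>1 * l\<^sup>2 * B = - (\<alpha> * (real n)\<^sup>2) * B - \<beta> * (real n)\<^sup>2 * C - b * real n * A - \<alpha>1 * B - \<alpha>3 * C - \<tau>1 * l * B - \<tau>2 * l * C"
    "\<kappa>2 * l\<^sup>2 * C = - (\<beta> * (real n)\<^sup>2) * B - \<gamma> * (real n)\<^sup>2 * C - d * real n * A - \<alpha>3 * B - \<alpha>2 * C - \<tau>3 * l * B - \<tau>4 * l * C"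
proof -
  let ?M = "vector [vector [\<rho> * l\<^sup>2 + \<mu> * (real n)\<^sup>2, b * real n, d * real n],
     vector [b * real n, \<kappa>1 * l\<^sup>2 + \<alpha> * (real n)\<^sup>2 + \<alpha>1 + \<tau>1 * l, \<beta> * (real n)\<^sup>2 + \<alpha>3 + \<tau>2 * l],
     vector [d * real n, \<beta> * (real n)\<^sup>2 + \<alpha>3 + \<tau>3 * l, \<kappa>2 * l\<^sup>2 + \<gamma> * (real n)\<^sup>2 + \<alpha>2 + \<tau>4 * l]] :: complex^3^3"
  have "det ?M = 0"
    using assms by (simp add: det_3 dispersion_def Let_def algebra_simps power2_eq_square)
  then have "\<not> invertible ?M" by (simp add: invertible_det_nz)
  then obtain x where x: "?M *v x = 0" "x \<noteq> 0"
    using matrix_left_invertible_ker[of ?M] by (auto simp: invertible_left_inverse)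
  have "(?M *v x) $ i = 0" for i using x(1) by simp
  from this[of 1] this[of 2] this[of 3]
  have e: "(\<rho> * l\<^sup>2 + \<mu> * (real n)\<^sup>2) * x$1 + b * real n * x$2 + d * real n * x$3 = 0"
    "b * real n * x$1 + (\<kappa>1 * l\<^sup>2 + \<alpha> * (real n)\<^sup>2 + \<alpha>1 + \<tau>1 * l) * x$2 + (\<beta> * (real n)\<^sup>2 + \<alpha>3 + \<tau>2 * l) * x$3 = 0"
    "d * real n * x$1 + (\<beta> * (real n)\<^sup>2 + \<alpha>3 + \<tau>3 * l) * x$2 + (\<kappa>2 * l\<^sup>2 + \<gamma> * (real n)\<^sup>2 + \<alpha>2 + \<tau>4 * l) * x$3 = 0"
    by (simp_all add: matrix_vector_mult_def sum_3)
  show ?thesis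
  proof (rule that[of "x$1" "x$2" "x$3"])
    show "\<not> (x$1 = 0 \<and> x$2 = 0 \<and> x$3 = 0)" using x(2) by (auto simp: vec_eq_iff forall_3)
  qed (use e in \<open>simp_all add: algebra_simps eq_neg_iff_add_eq_0\<close>)
qed

text \<open>At $\lambda = i\omega n$ with $\omega^2 = \mu/\rho$ the entry $\rho\lambda^2 + \mu n^2$ of the first
  equation vanishes. The values of the determinant and of its derivative are expressed as a power of
  $n$ times a polynomial in $y = 1/n$, which makes their growth as $n \to \infty$ visible.\<close>

lemma dispersion_at_wave_root:
  fixes n :: nat and \<rho> \<kappa>1 \<kappa>2 \<mu> \<alpha> \<beta> \<gamma> \<alpha>1 \<alpha>2 \<alpha>3 b d \<tau>1 \<tau>2 \<tau>3 \<tau>4 \<omega> p r :: real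
    and N y P Q R S :: complex
  defines "N \<equiv> of_nat n" and "y \<equiv> inverse (of_nat n)"
  assumes n: "n > 0" and rho: "\<rho> > 0" and w: "\<rho> * \<omega>\<^sup>2 = \<mu>"
    and p: "p = \<mu> * \<kappa>1 / \<rho> - \<alpha>" and r: "r = \<mu> * \<kappa>2 / \<rho> - \<gamma>"
  defines "P \<equiv> - p + \<alpha>1 * y\<^sup>2 + \<i> * \<omega> * \<tau>1 * y" and "R \<equiv> - r + \<alpha>2 * y\<^sup>2 + \<i> * \<omega> * \<tau>4 * y"
    and "Q \<equiv> \<beta> + \<alpha>3 * y\<^sup>2 + \<i> * \<omega> * \<tau>2 * y" and "S \<equiv> \<beta> + \<alpha>3 * y\<^sup>2 + \<i> * \<omega> * \<tau>3 * y"
  shows "poly (dispersion \<rho> \<kappa>1 \<kappa>2 \<mu> \<alpha> \<beta> \<gamma> \<alpha>1 \<alpha>2 \<alpha>3 b d \<tau>1 \<tau>2 \<tau>3 \<tau>4 n) (\<i> * \<omega> * N)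
      = - (N^4) * (b\<^sup>2 * R + d\<^sup>2 * P - b * d * (Q + S))"
   "poly (pderiv (dispersion \<rho> \<kappa>1 \<kappa>2 \<mu> \<alpha> \<beta> \<gamma> \<alpha>1 \<alpha>2 \<alpha>3 b d \<tau>1 \<tau>2 \<tau>3 \<tau>4 n)) (\<i> * \<omega> * N)
      = N^5 * (2 * \<rho> * \<i> * \<omega> * (P * R - Q * S)
        - y\<^sup>2 * (b\<^sup>2 * (2 * \<kappa>2 * \<i> * \<omega> + \<tau>4 * y) + d\<^sup>2 * (2 * \<kappa>1 * \<i> * \<omega> + \<tau>1 * y) - b * d * (\<tau>2 + \<tau>3) * y))"
proof -
  have Ny: "N * y = 1" using n by (simp add: N_def y_def)
  define l where "l = \<i> * \<omega> * N"
  have N0: "N \<noteq> 0" using n by (simp add: N_def)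
  have yN: "y = 1 / N" by (simp add: N_def y_def inverse_eq_divide)
  have pr: "p = \<omega>\<^sup>2 * \<kappa>1 - \<alpha>" "r = \<omega>\<^sup>2 * \<kappa>2 - \<gamma>" using rho unfolding p r w[symmetric] by simp_all
  have l2: "l\<^sup>2 = - (\<omega>\<^sup>2 * N\<^sup>2)" by (simp add: l_def power_mult_distrib)
  have ent: "\<alpha> * N\<^sup>2 + \<alpha>1 + \<tau>1 * l + \<kappa>1 * l\<^sup>2 = N\<^sup>2 * P" "\<gamma> * N\<^sup>2 + \<alpha>2 + \<tau>4 * l + \<kappa>2 * l\<^sup>2 = N\<^sup>2 * R"
    "\<beta> * N\<^sup>2 + \<alpha>3 + \<tau>2 * l = N\<^sup>2 * Q" "\<beta> * N\<^sup>2 + \<alpha>3 + \<tau>3 * l = N\<^sup>2 * S"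
    unfolding l2 unfolding P_def R_def Q_def S_def pr yN l_def using N0
    by (simp_all add: field_simps power2_eq_square)
  have zero: "\<mu> * N\<^sup>2 + \<rho> * l\<^sup>2 = 0" unfolding l2 w[symmetric] by (simp add: algebra_simps)
  define pp where "pp = [:of_real \<alpha> * N\<^sup>2 + of_real \<alpha>1, of_real \<tau>1, of_real \<kappa>1:]"
  define qq where "qq = [:of_real \<beta> * N\<^sup>2 + of_real \<alpha>3, of_real \<tau>2:]"
  define ss where "ss = [:of_real \<beta> * N\<^sup>2 + of_real \<alpha>3, of_real \<tau>3:]"
  define rr where "rr = [:of_real \<gamma> * N\<^sup>2 + of_real \<alpha>2, of_real \<tau>4, of_real \<kappa>2:]"
  define uu where "uu = [:of_real \<mu> * N\<^sup>2, 0, of_real \<rho>:]"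
  have disp: "dispersion \<rho> \<kappa>1 \<kappa>2 \<mu> \<alpha> \<beta> \<gamma> \<alpha>1 \<alpha>2 \<alpha>3 b d \<tau>1 \<tau>2 \<tau>3 \<tau>4 n = uu * (pp * rr - qq * ss)
        - smult (N\<^sup>2) (smult (of_real (b\<^sup>2)) rr + smult (of_real (d\<^sup>2)) pp - smult (of_real (b * d)) (qq + ss))"
    unfolding dispersion_def Let_def N_def pp_def qq_def rr_def ss_def uu_def ..
  have val: "poly pp l = N\<^sup>2 * P" "poly rr l = N\<^sup>2 * R" "poly qq l = N\<^sup>2 * Q" "poly ss l = N\<^sup>2 * S"
    unfolding ent[symmetric] pp_def qq_def rr_def ss_def uu_def
    by (simp_all add: algebra_simps power2_eq_square)
  have zval: "poly uu l = 0"
    using zero unfolding uu_def by (simp add: algebra_simps power2_eq_square)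
  have dval: "poly (pderiv pp) l = \<tau>1 + 2 * \<kappa>1 * l" "poly (pderiv rr) l = \<tau>4 + 2 * \<kappa>2 * l"
     "poly (pderiv qq) l = \<tau>2" "poly (pderiv ss) l = \<tau>3" "poly (pderiv uu) l = 2 * \<rho> * l"
    unfolding pp_def qq_def rr_def ss_def uu_def by (simp_all add: pderiv_pCons algebra_simps)
  show "poly (dispersion \<rho> \<kappa>1 \<kappa>2 \<mu> \<alpha> \<beta> \<gamma> \<alpha>1 \<alpha>2 \<alpha>3 b d \<tau>1 \<tau>2 \<tau>3 \<tau>4 n) (\<i> * \<omega> * N)
      = - (N^4) * (b\<^sup>2 * R + d\<^sup>2 * P - b * d * (Q + S))"
    unfolding disp l_def[symmetric] by (simp add: val zval algebra_simps power2_eq_square power4_eq_xxxx)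
  have "poly (pderiv (dispersion \<rho> \<kappa>1 \<kappa>2 \<mu> \<alpha> \<beta> \<gamma> \<alpha>1 \<alpha>2 \<alpha>3 b d \<tau>1 \<tau>2 \<tau>3 \<tau>4 n)) l
      = 2 * \<rho> * l * (N^4 * (P * R - Q * S))
       - N\<^sup>2 * (b\<^sup>2 * (\<tau>4 + 2 * \<kappa>2 * l) + d\<^sup>2 * (\<tau>1 + 2 * \<kappa>1 * l) - b * d * (\<tau>2 + \<tau>3))"
    unfolding disp
    by (simp add: pderiv_diff pderiv_add pderiv_mult pderiv_smult val zval dval algebra_simps power2_eq_square power4_eq_xxxx)
  also have "\<dots> = N^5 * (2 * \<rho> * \<i> * \<omega> * (P * R - Q * S)
        - y\<^sup>2 * (b\<^sup>2 * (2 * \<kappa>2 * \<i> * \<omega> + \<tau>4 * y) + d\<^sup>2 * (2 * \<kappa>1 * \<i> * \<omega> + \<tau>1 * y) - b * d * (\<tau>2 + \<tau>3) * y))"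
    unfolding l_def yN using N0 by (simp add: field_simps power2_eq_square eval_nat_numeral)
  finally show "poly (pderiv (dispersion \<rho> \<kappa>1 \<kappa>2 \<mu> \<alpha> \<beta> \<gamma> \<alpha>1 \<alpha>2 \<alpha>3 b d \<tau>1 \<tau>2 \<tau>3 \<tau>4 n)) (\<i> * \<omega> * N)
      = N^5 * (2 * \<rho> * \<i> * \<omega> * (P * R - Q * S)
        - y\<^sup>2 * (b\<^sup>2 * (2 * \<kappa>2 * \<i> * \<omega> + \<tau>4 * y) + d\<^sup>2 * (2 * \<kappa>1 * \<i> * \<omega> + \<tau>1 * y) - b * d * (\<tau>2 + \<tau>3) * y))"
    unfolding l_def .
qed

text \<open>When $\chi_0$ vanishes, the derivative of the determinant is governed by its next order in $1/n$,
  whose coefficient is a nonzero multiple of the expression below. Multiplied by $p$, and with $pr = \beta^2$, it becomes the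
  dissipation form $\tau_1 \beta^2 + (\tau_2+\tau_3) \beta p + \tau_4 p^2$, which is definite.\<close>

lemma damping_correction_nonzero:
  fixes p r \<beta> :: real
  assumes "p * r = \<beta>\<^sup>2" "\<beta> > 0" "\<tau>1 > 0" "4 * \<tau>1 * \<tau>4 > (\<tau>2 + \<tau>3)\<^sup>2"
  shows "p * \<tau>4 + r * \<tau>1 + \<beta> * (\<tau>2 + \<tau>3) \<noteq> 0"
proof
  assume "p * \<tau>4 + r * \<tau>1 + \<beta> * (\<tau>2 + \<tau>3) = 0"
  then have "4 * \<tau>1 * (p * (p * \<tau>4 + r * \<tau>1 + \<beta> * (\<tau>2 + \<tau>3))) = 0" by simp
  also have "4 * \<tau>1 * (p * (p * \<tau>4 + r * \<tau>1 + \<beta> * (\<tau>2 + \<tau>3)))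
     = (2 * \<tau>1 * \<beta> + (\<tau>2 + \<tau>3) * p)\<^sup>2 + (4 * \<tau>1 * \<tau>4 - (\<tau>2 + \<tau>3)\<^sup>2) * p\<^sup>2 + 4 * \<tau>1\<^sup>2 * (p * r - \<beta>\<^sup>2)"
    by (simp add: algebra_simps power2_eq_square)
  finally have "(2 * \<tau>1 * \<beta> + (\<tau>2 + \<tau>3) * p)\<^sup>2 + (4 * \<tau>1 * \<tau>4 - (\<tau>2 + \<tau>3)\<^sup>2) * p\<^sup>2 = 0"
    using assms(1) by simp
  moreover have "p \<noteq> 0" using assms(1,2) by auto
  then have "(4 * \<tau>1 * \<tau>4 - (\<tau>2 + \<tau>3)\<^sup>2) * p\<^sup>2 > 0" using assms(4) by simp
  ultimately show False using zero_le_power2[of "2 * \<tau>1 * \<beta> + (\<tau>2 + \<tau>3) * p"] by linarith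
qed

text \<open>At $\lambda = i\omega n$ the determinant equals $\chi_1 n^4 + O(n^3)$ and its derivative
  $2 i \rho\omega \chi_0 n^5 + O(n^4)$. If $\chi_0 \ne 0$, the quotient is $O(1/n)$ and the scale is $n^5$. If
  $\chi_0 = \chi_1 = 0$, both drop by one order, and the derivative retains a nonzero leading
  coefficient by \<open>damping_correction_nonzero\<close>; the scale is then $n^4$. In the remaining case
  $\chi_0 = 0 \ne \chi_1$ the quotient stays away from $0$.\<close>

lemma dispersion_newton_correction_vanishes:
  fixes \<rho> \<kappa>1 \<kappa>2 \<mu> \<alpha> \<beta> \<gamma> \<alpha>1 \<alpha>2 \<alpha>3 b d \<tau>1 \<tau>2 \<tau>3 \<tau>4 \<omega> :: real
  assumes rho: "\<rho> > 0" and w: "\<rho> * \<omega>\<^sup>2 = \<mu>" "\<omega> > 0"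
    and beta: "\<beta> > 0" and tau: "\<tau>1 > 0" "4 * \<tau>1 * \<tau>4 > (\<tau>2 + \<tau>3)\<^sup>2"
    and chi: "\<not> (chi0 \<rho> \<kappa>1 \<kappa>2 \<mu> \<alpha> \<beta> \<gamma> = 0 \<and> chi1 \<rho> \<kappa>1 \<kappa>2 \<mu> \<alpha> \<beta> \<gamma> b d \<noteq> 0)"
  defines "D \<equiv> dispersion \<rho> \<kappa>1 \<kappa>2 \<mu> \<alpha> \<beta> \<gamma> \<alpha>1 \<alpha>2 \<alpha>3 b d \<tau>1 \<tau>2 \<tau>3 \<tau>4"
  obtains k L where "L \<noteq> 0" "(\<lambda>n. poly (D n) (\<i> * \<omega> * of_nat n) / of_nat n ^ k) \<longlonglongrightarrow> 0"
     "(\<lambda>n. poly (pderiv (D n)) (\<i> * \<omega> * of_nat n) / of_nat n ^ k) \<longlonglongrightarrow> L"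
proof -
  define p where "p = \<mu> * \<kappa>1 / \<rho> - \<alpha>"
  define r where "r = \<mu> * \<kappa>2 / \<rho> - \<gamma>"
  define y where "y = (\<lambda>n. inverse (of_nat n) :: complex)"
  define P where "P = (\<lambda>n. - p + \<alpha>1 * (y n)\<^sup>2 + \<i> * \<omega> * \<tau>1 * y n)"
  define R where "R = (\<lambda>n. - r + \<alpha>2 * (y n)\<^sup>2 + \<i> * \<omega> * \<tau>4 * y n)"
  define Q where "Q = (\<lambda>n. \<beta> + \<alpha>3 * (y n)\<^sup>2 + \<i> * \<omega> * \<tau>2 * y n)"
  define S where "S = (\<lambda>n. \<beta> + \<alpha>3 * (y n)\<^sup>2 + \<i> * \<omega> * \<tau>3 * y n)"
  define G where "G = (\<lambda>n. b\<^sup>2 * (2 * \<kappa>2 * \<i> * \<omega> + \<tau>4 * y n) + d\<^sup>2 * (2 * \<kappa>1 * \<i> * \<omega> + \<tau>1 * y n) - b * d * (\<tau>2 + \<tau>3) * y n)"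
  define K where "K = (\<lambda>n. b\<^sup>2 * R n + d\<^sup>2 * P n - b * d * (Q n + S n))"
  have y0: "y \<longlonglongrightarrow> 0" unfolding y_def by (rule lim_inverse_n)
  have Ny: "y n = 1 / of_nat n" for n by (simp add: y_def inverse_eq_divide)
  have D: "poly (D n) (\<i> * \<omega> * of_nat n) = - (of_nat n ^ 4) * K n"
    "poly (pderiv (D n)) (\<i> * \<omega> * of_nat n) = of_nat n ^ 5 * (2 * \<rho> * \<i> * \<omega> * (P n * R n - Q n * S n) - (y n)\<^sup>2 * G n)"
    if "n > 0" for n
    using dispersion_at_wave_root[OF that rho w(1) p_def r_def]
    unfolding D_def K_def P_def Q_def R_def S_def G_def y_def by blast+
  have lim: "P \<longlonglongrightarrow> - complex_of_real p" "R \<longlonglongrightarrow> - complex_of_real r" "Q \<longlonglongrightarrow> \<beta>" "S \<longlonglongrightarrow> \<beta>"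
    unfolding P_def Q_def R_def S_def by (rule tendsto_eq_intros y0 refl | simp)+
  define g where "g = b\<^sup>2 * (2 * \<kappa>2 * \<i> * \<omega>) + d\<^sup>2 * (2 * \<kappa>1 * \<i> * \<omega>)"
  have limG: "G \<longlonglongrightarrow> g"
    unfolding G_def g_def by (rule tendsto_eq_intros y0 refl | simp)+
  define c0 where "c0 = chi0 \<rho> \<kappa>1 \<kappa>2 \<mu> \<alpha> \<beta> \<gamma>"
  define c1 where "c1 = chi1 \<rho> \<kappa>1 \<kappa>2 \<mu> \<alpha> \<beta> \<gamma> b d"
  have c: "c0 = p * r - \<beta>\<^sup>2" "c1 = d\<^sup>2 * p + b\<^sup>2 * r + 2 * b * d * \<beta>"
    by (simp_all add: c0_def c1_def chi0_def chi1_def p_def r_def)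
  have coupling: "(\<lambda>n. - K n) \<longlonglongrightarrow> c1"
  proof -
    have "(\<lambda>n. - K n)
       \<longlonglongrightarrow> - (b\<^sup>2 * (- complex_of_real r) + d\<^sup>2 * (- complex_of_real p) - b * d * (complex_of_real \<beta> + \<beta>))"
      unfolding K_def by (intro tendsto_intros lim)
    also have "- (b\<^sup>2 * (- complex_of_real r) + d\<^sup>2 * (- complex_of_real p) - b * d * (complex_of_real \<beta> + \<beta>)) = c1"
      unfolding c by (simp add: algebra_simps)
    finally show ?thesis .
  qed
  show ?thesis
  proof (cases "c0 = 0")
    case False
    show ?thesis
    proof (rule that[of "2 * \<rho> * \<i> * \<omega> * c0" 5])
      show "2 * \<rho> * \<i> * \<omega> * c0 \<noteq> 0" using False rho w by simp
      have "(\<lambda>n. y n * - K n) \<longlonglongrightarrow> 0 * complex_of_real c1"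
        by (intro tendsto_mult y0 coupling)
      moreover have "\<forall>\<^sub>F n in sequentially. y n * - K n
         = poly (D n) (\<i> * \<omega> * of_nat n) / of_nat n ^ 5"
        using eventually_gt_at_top[of 0] by eventually_elim (simp add: D Ny eval_nat_numeral)
      ultimately show "(\<lambda>n. poly (D n) (\<i> * \<omega> * of_nat n) / of_nat n ^ 5) \<longlonglongrightarrow> 0"
        by (simp add: Lim_transform_eventually)
      have "(\<lambda>n. 2 * \<rho> * \<i> * \<omega> * (P n * R n - Q n * S n) - (y n)\<^sup>2 * G n)
          \<longlonglongrightarrow> 2 * \<rho> * \<i> * \<omega> * (- complex_of_real p * - complex_of_real r - complex_of_real \<beta> * \<beta>)
            - 0\<^sup>2 * g"
        by (intro tendsto_intros lim limG y0)
      also have "2 * \<rho> * \<i> * \<omega> * (- complex_of_real p * - complex_of_real r - complex_of_real \<beta> * \<beta>)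
            - 0\<^sup>2 * g
          = 2 * \<rho> * \<i> * \<omega> * c0"
        unfolding c by (simp add: power2_eq_square)
      finally have "(\<lambda>n. 2 * \<rho> * \<i> * \<omega> * (P n * R n - Q n * S n) - (y n)\<^sup>2 * G n) \<longlonglongrightarrow> 2 * \<rho> * \<i> * \<omega> * c0" .
      moreover have "\<forall>\<^sub>F n in sequentially. 2 * \<rho> * \<i> * \<omega> * (P n * R n - Q n * S n) - (y n)\<^sup>2 * G n
         = poly (pderiv (D n)) (\<i> * \<omega> * of_nat n) / of_nat n ^ 5"
        using eventually_gt_at_top[of 0] by eventually_elim (simp add: D)
      ultimately show "(\<lambda>n. poly (pderiv (D n)) (\<i> * \<omega> * of_nat n) / of_nat n ^ 5) \<longlonglongrightarrow> 2 * \<rho> * \<i> * \<omega> * c0"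
        by (rule Lim_transform_eventually)
    qed
  next
    case True
    then have c1: "c1 = 0" using chi by (simp add: c0_def c1_def)
    define e where "e = p * \<tau>4 + r * \<tau>1 + \<beta> * (\<tau>2 + \<tau>3)"
    have e: "e \<noteq> 0" unfolding e_def using True c(1) by (intro damping_correction_nonzero beta tau) simp
    have pr: "p * r = \<beta>\<^sup>2" using True c(1) by simp
    \<comment> \<open>Since $\chi_0 = 0$, the principal minor \<open>P * R - Q * S\<close> is divisible by \<open>y\<close>; \<open>H\<close> is the quotient.\<close>
    define H where "H = (\<lambda>n. - (\<i> * \<omega> * e) + y n * (- p * \<alpha>2 - r * \<alpha>1 - 2 * \<beta> * \<alpha>3 - \<omega>\<^sup>2 * (\<tau>1 * \<tau>4 - \<tau>2 * \<tau>3))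
      + (y n)\<^sup>2 * (\<i> * \<omega> * (\<alpha>1 * \<tau>4 + \<alpha>2 * \<tau>1 - \<alpha>3 * (\<tau>2 + \<tau>3))) + (y n)^3 * (\<alpha>1 * \<alpha>2 - \<alpha>3\<^sup>2))"
    have H: "P n * R n - Q n * S n = y n * H n" for n
    proof -
      have "complex_of_real p * r = \<beta>\<^sup>2" using pr by (metis of_real_mult of_real_power)
      then show ?thesis
        unfolding P_def Q_def R_def S_def H_def e_def
        by (simp add: algebra_simps power2_eq_square power3_eq_cube)
    qed
    have limH: "H \<longlonglongrightarrow> - (\<i> * \<omega> * e)"
      unfolding H_def by (rule tendsto_eq_intros y0 refl | simp)+
    show ?thesis
    proof (rule that[of "- (2 * \<rho> * \<i> * \<omega> * (\<i> * \<omega> * e))" 4])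
      show "- (2 * \<rho> * \<i> * \<omega> * (\<i> * \<omega> * e)) \<noteq> 0" using e rho w by simp
      have "\<forall>\<^sub>F n in sequentially. - K n
         = poly (D n) (\<i> * \<omega> * of_nat n) / of_nat n ^ 4"
        using eventually_gt_at_top[of 0] by eventually_elim (simp add: D)
      with coupling show "(\<lambda>n. poly (D n) (\<i> * \<omega> * of_nat n) / of_nat n ^ 4) \<longlonglongrightarrow> 0"
        unfolding c1 by (simp add: Lim_transform_eventually)
      have "(\<lambda>n. 2 * \<rho> * \<i> * \<omega> * H n - y n * G n) \<longlonglongrightarrow> 2 * \<rho> * \<i> * \<omega> * (- (\<i> * \<omega> * e))
          - 0 * g"
        by (intro tendsto_intros limH limG y0)
      moreover have "\<forall>\<^sub>F n in sequentially. 2 * \<rho> * \<i> * \<omega> * H n - y n * G n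
         = poly (pderiv (D n)) (\<i> * \<omega> * of_nat n) / of_nat n ^ 4"
        using eventually_gt_at_top[of 0]
      proof eventually_elim
        case (elim n)
        have "of_nat n ^ 5 * y n = of_nat n ^ 4" using elim by (simp add: Ny eval_nat_numeral)
        then have "of_nat n ^ 5 * (2 * \<rho> * \<i> * \<omega> * (y n * H n) - (y n)\<^sup>2 * G n)
          = of_nat n ^ 4 * (2 * \<rho> * \<i> * \<omega> * H n - y n * G n)"
          unfolding power2_eq_square by (simp add: right_diff_distrib flip: mult.assoc)
        then show ?case unfolding D[OF elim] H using elim by simp
      qed
      ultimately show "(\<lambda>n. poly (pderiv (D n)) (\<i> * \<omega> * of_nat n) / of_nat n ^ 4)
          \<longlonglongrightarrow> - (2 * \<rho> * \<i> * \<omega> * (\<i> * \<omega> * e))"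
        by (simp add: Lim_transform_eventually)
    qed
  qed
qed

lemma dispersion_root_near_wave_root:
  fixes \<rho> \<kappa>1 \<kappa>2 \<mu> \<alpha> \<beta> \<gamma> \<alpha>1 \<alpha>2 \<alpha>3 b d \<tau>1 \<tau>2 \<tau>3 \<tau>4 \<omega> \<epsilon> :: real
  assumes "\<rho> > 0" "\<rho> * \<omega>\<^sup>2 = \<mu>" "\<omega> > 0" "\<beta> > 0" "\<tau>1 > 0" "4 * \<tau>1 * \<tau>4 > (\<tau>2 + \<tau>3)\<^sup>2"
    "\<not> (chi0 \<rho> \<kappa>1 \<kappa>2 \<mu> \<alpha> \<beta> \<gamma> = 0 \<and> chi1 \<rho> \<kappa>1 \<kappa>2 \<mu> \<alpha> \<beta> \<gamma> b d \<noteq> 0)"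
    and eps: "\<epsilon> > 0"
  obtains n l where "n > 0" "norm (\<i> * \<omega> * of_nat n - l) < \<epsilon>"
    "poly (dispersion \<rho> \<kappa>1 \<kappa>2 \<mu> \<alpha> \<beta> \<gamma> \<alpha>1 \<alpha>2 \<alpha>3 b d \<tau>1 \<tau>2 \<tau>3 \<tau>4 n) l = 0"
proof -
  define D where "D = dispersion \<rho> \<kappa>1 \<kappa>2 \<mu> \<alpha> \<beta> \<gamma> \<alpha>1 \<alpha>2 \<alpha>3 b d \<tau>1 \<tau>2 \<tau>3 \<tau>4"
  obtain k L where L: "L \<noteq> 0" and lim: "(\<lambda>n. poly (D n) (\<i> * \<omega> * of_nat n) / of_nat n ^ k) \<longlonglongrightarrow> 0"
     "(\<lambda>n. poly (pderiv (D n)) (\<i> * \<omega> * of_nat n) / of_nat n ^ k) \<longlonglongrightarrow> L"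
    using dispersion_newton_correction_vanishes[OF assms(1-7)] unfolding D_def by blast
  have "(\<lambda>n. 6 * norm (poly (D n) (\<i> * \<omega> * of_nat n) / of_nat n ^ k)
      - \<epsilon> * norm (poly (pderiv (D n)) (\<i> * \<omega> * of_nat n) / of_nat n ^ k)) \<longlonglongrightarrow> 6 * norm (0::complex) - \<epsilon> * norm L"
    by (intro tendsto_intros lim)
  then have "\<forall>\<^sub>F n in sequentially. 6 * norm (poly (D n) (\<i> * \<omega> * of_nat n) / of_nat n ^ k)
      - \<epsilon> * norm (poly (pderiv (D n)) (\<i> * \<omega> * of_nat n) / of_nat n ^ k) < 0"
    using L eps by (intro order_tendstoD(2)) auto
  with eventually_gt_at_top[of 0] have "\<forall>\<^sub>F n in sequentially. n > 0 \<and>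
     6 * norm (poly (D n) (\<i> * \<omega> * of_nat n)) < \<epsilon> * norm (poly (pderiv (D n)) (\<i> * \<omega> * of_nat n))"
    by eventually_elim (simp add: norm_divide norm_power field_simps)
  then obtain n where n: "n > 0"
     "6 * norm (poly (D n) (\<i> * \<omega> * of_nat n)) < \<epsilon> * norm (poly (pderiv (D n)) (\<i> * \<omega> * of_nat n))"
    using eventually_happens'[OF trivial_limit_sequentially] by blast
  have "\<exists>l. poly (D n) l = 0 \<and> norm (\<i> * \<omega> * of_nat n - l) < \<epsilon>"
  proof (rule ccontr)
    assume "\<not> ?thesis"
    then have "\<epsilon> * norm (poly (pderiv (D n)) (\<i> * \<omega> * of_nat n)) \<le> degree (D n) * norm (poly (D n) (\<i> * \<omega> * of_nat n))"
      by (intro pderiv_bound_if_no_root_near eps) (auto simp: not_less)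
    also have "\<dots> \<le> 6 * norm (poly (D n) (\<i> * \<omega> * of_nat n))"
      using degree_dispersion unfolding D_def by (intro mult_right_mono) auto
    finally show False using n(2) by simp
  qed
  then show ?thesis using that n(1) unfolding D_def by blast
qed

section \<open>Exponential solutions and the failure of exponential decay\<close>

definition osc :: "complex \<Rightarrow> complex \<Rightarrow> real \<Rightarrow> real" where
  "osc l A t = Re (A * exp (l * of_real t))"

lemma osc_deriv: "(osc l A has_real_derivative osc l (l * A) t) (at t)"
proof -
  have "((\<lambda>z. A * exp (l * z)) has_field_derivative l * A * exp (l * of_real t)) (at (of_real t))"
    by (auto intro!: derivative_eq_intros)
  then have "((\<lambda>t. A * exp (l * of_real t)) has_vector_derivative l * A * exp (l * of_real t)) (at t)"
    by (rule has_vector_derivative_real_field)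
  from bounded_linear.has_vector_derivative[OF bounded_linear_Re this]
  show ?thesis unfolding osc_def has_real_derivative_iff_has_vector_derivative .
qed

lemma osc_continuous: "continuous_on UNIV (osc l A)"
  using osc_deriv DERIV_isCont by (blast intro: continuous_at_imp_continuous_on)

text \<open>The real part of an exponential solution is a semigroup solution. Its time integral has the
  amplitudes $\mathrm{Re}\,(X (e^{\lambda t} - 1)/\lambda)$, so the integrated equations are the
  algebraic ones multiplied by $(e^{\lambda t} - 1)/\lambda$.\<close>

lemma exponential_mode_solution:
  fixes \<rho> \<kappa>1 \<kappa>2 \<mu> \<alpha> \<beta> \<gamma> \<alpha>1 \<alpha>2 \<alpha>3 b d \<tau>1 \<tau>2 \<tau>3 \<tau>4 :: real and l A B C :: complex
  assumes n: "n > 0" and l: "l \<noteq> 0"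
    and sys: "\<rho> * l\<^sup>2 * A = - (\<mu> * (real n)\<^sup>2) * A - b * real n * B - d * real n * C"
    "\<kappa>1 * l\<^sup>2 * B = - (\<alpha> * (real n)\<^sup>2) * B - \<beta> * (real n)\<^sup>2 * C - b * real n * A - \<alpha>1 * B - \<alpha>3 * C - \<tau>1 * l * B - \<tau>2 * l * C"
    "\<kappa>2 * l\<^sup>2 * C = - (\<beta> * (real n)\<^sup>2) * B - \<gamma> * (real n)\<^sup>2 * C - d * real n * A - \<alpha>3 * B - \<alpha>2 * C - \<tau>3 * l * B - \<tau>4 * l * C"
  shows "semigroup_solution \<rho> \<kappa>1 \<kappa>2 \<mu> \<alpha> \<beta> \<gamma> \<alpha>1 \<alpha>2 \<alpha>3 b d \<tau>1 \<tau>2 \<tau>3 \<tau>4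
    (\<lambda>t. sin_mode n (osc l A t)) (\<lambda>t. sin_mode n (osc l (l * A) t))
    (\<lambda>t. cos_mode n (osc l B t)) (\<lambda>t. cos_mode n (osc l (l * B) t))
    (\<lambda>t. cos_mode n (osc l C t)) (\<lambda>t. cos_mode n (osc l (l * C) t))"
proof -
  define E where "E = (\<lambda>t. (exp (l * of_real t) - 1) / l)"
  have diff: "osc l Y t - osc l Y 0 = Re (Y * l * E t)" for Y t
  proof -
    have "Y * l * E t = Y * exp (l * of_real t) - Y" using l by (simp add: E_def field_simps)
    then show ?thesis by (simp add: osc_def)
  qed
  have osc_E: "osc l (X / l) t - osc l (X / l) 0 = Re (X * E t)" "osc l X t - osc l X 0 = Re (l * X * E t)"
     "osc l (l * X) t - osc l (l * X) 0 = Re (l\<^sup>2 * X * E t)" for X t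
    using l unfolding diff by (simp_all add: power2_eq_square ac_simps)
  have prim: "((\<lambda>t. osc l (X / l) t - osc l (X / l) 0) has_real_derivative osc l X t) (at t)" for X t
    using l osc_deriv[of l "X / l" t] by (auto intro!: derivative_eq_intros)
  show ?thesis
  proof (rule mode_semigroup_solution[OF n _ _ _ prim prim prim osc_deriv osc_deriv osc_deriv
        osc_continuous osc_continuous osc_continuous])
    fix t
    have "Re (\<rho> * l\<^sup>2 * A * E t) = Re ((- (\<mu> * (real n)\<^sup>2) * A - b * real n * B - d * real n * C) * E t)"
      unfolding sys(1) ..
    then show "\<rho> * (osc l (l * A) t - osc l (l * A) 0) = - (\<mu> * (real n)\<^sup>2) * (osc l (A / l) t - osc l (A / l) 0)
       - b * real n * (osc l (B / l) t - osc l (B / l) 0) - d * real n * (osc l (C / l) t - osc l (C / l) 0)"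
      unfolding osc_E(1) unfolding osc_E(3) unfolding osc_E(2) by (simp add: algebra_simps)
    have "Re (\<kappa>1 * l\<^sup>2 * B * E t) = Re ((- (\<alpha> * (real n)\<^sup>2) * B - \<beta> * (real n)\<^sup>2 * C - b * real n * A - \<alpha>1 * B - \<alpha>3 * C - \<tau>1 * l * B - \<tau>2 * l * C) * E t)"
      unfolding sys(2) ..
    then show "\<kappa>1 * (osc l (l * B) t - osc l (l * B) 0) = - (\<alpha> * (real n)\<^sup>2) * (osc l (B / l) t - osc l (B / l) 0)
       - \<beta> * (real n)\<^sup>2 * (osc l (C / l) t - osc l (C / l) 0) - b * real n * (osc l (A / l) t - osc l (A / l) 0)
       - \<alpha>1 * (osc l (B / l) t - osc l (B / l) 0) - \<alpha>3 * (osc l (C / l) t - osc l (C / l) 0)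
       - \<tau>1 * (osc l B t - osc l B 0) - \<tau>2 * (osc l C t - osc l C 0)"
      unfolding osc_E(1) unfolding osc_E(3) unfolding osc_E(2) by (simp add: algebra_simps)
    have "Re (\<kappa>2 * l\<^sup>2 * C * E t) = Re ((- (\<beta> * (real n)\<^sup>2) * B - \<gamma> * (real n)\<^sup>2 * C - d * real n * A - \<alpha>3 * B - \<alpha>2 * C - \<tau>3 * l * B - \<tau>4 * l * C) * E t)"
      unfolding sys(3) ..
    then show "\<kappa>2 * (osc l (l * C) t - osc l (l * C) 0) = - (\<beta> * (real n)\<^sup>2) * (osc l (B / l) t - osc l (B / l) 0)
       - \<gamma> * (real n)\<^sup>2 * (osc l (C / l) t - osc l (C / l) 0) - d * real n * (osc l (A / l) t - osc l (A / l) 0)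
       - \<alpha>3 * (osc l (B / l) t - osc l (B / l) 0) - \<alpha>2 * (osc l (C / l) t - osc l (C / l) 0)
       - \<tau>3 * (osc l B t - osc l B 0) - \<tau>4 * (osc l C t - osc l C 0)"
      unfolding osc_E(1) unfolding osc_E(3) unfolding osc_E(2) by (simp add: algebra_simps)
  qed simp_all
qed

text \<open>After full periods of the oscillation the phase returns and only the factor
  $e^{\mathrm{Re}\,\lambda\, t}$ remains; sampling there makes the energy comparable with its initial
  value although the energy of the real part may oscillate in between.\<close>

lemma osc_period:
  assumes "Im l \<noteq> 0"
  shows "osc l A (2 * pi * real k / Im l) = exp (Re l * (2 * pi * real k / Im l)) * osc l A 0"
proof -
  let ?t = "2 * pi * real k / Im l"
  have "exp (l * of_real ?t) = of_real (exp (Re l * ?t)) * cis (Im l * ?t)"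
    by (simp add: exp_eq_polar)
  also have "cis (Im l * ?t) = 1"
    using assms cis_multiple_2pi[of "real k"] by simp
  finally show ?thesis by (simp add: osc_def)
qed

text \<open>A nonzero imaginary amplitude has vanishing real part, but then the initial velocity is nonzero.
  Hence the energy of the real part of an exponential solution is positive at time $0$.\<close>

lemma osc_initial_nonzero:
  assumes "Im l \<noteq> 0" "A \<noteq> 0"
  shows "\<not> (osc l A 0 = 0 \<and> osc l (l * A) 0 = 0)"
  using assms by (auto simp: osc_def complex_eq_iff)

theorem theorem6:
  fixes \<rho> \<kappa>1 \<kappa>2 \<mu> \<alpha> \<beta> \<gamma> \<alpha>1 \<alpha>2 \<alpha>3 b d \<tau>1 \<tau>2 \<tau>3 \<tau>4 :: real
  assumes "\<rho> > 0" "\<kappa>1 > 0" "\<kappa>2 > 0"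
    and "\<mu> > 0" "\<alpha> > 0" "\<beta> > 0" "\<gamma> > 0" "\<alpha>1 > 0" "\<alpha>2 > 0"
    and "\<not> (b = 0 \<and> d = 0)"
    and "positive_definite (coefficient_matrix \<mu> \<alpha> \<beta> \<gamma> \<alpha>1 \<alpha>2 \<alpha>3 b d)"
    and "\<tau>1 > 0" "4 * \<tau>1 * \<tau>4 > (\<tau>2 + \<tau>3)\<^sup>2"
    and "\<not> (chi0 \<rho> \<kappa>1 \<kappa>2 \<mu> \<alpha> \<beta> \<gamma> = 0 \<and> chi1 \<rho> \<kappa>1 \<kappa>2 \<mu> \<alpha> \<beta> \<gamma> b d \<noteq> 0)"
  shows "\<not> (\<exists>M \<xi>. M > 0 \<and> \<xi> > 0 \<and>
    (\<forall>u v \<phi> w \<psi> z.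
       semigroup_solution \<rho> \<kappa>1 \<kappa>2 \<mu> \<alpha> \<beta> \<gamma> \<alpha>1 \<alpha>2 \<alpha>3 b d \<tau>1 \<tau>2 \<tau>3 \<tau>4 u v \<phi> w \<psi> z \<longrightarrow>
       (\<forall>t\<ge>0. energy \<rho> \<kappa>1 \<kappa>2 \<mu> \<alpha> \<beta> \<gamma> \<alpha>1 \<alpha>2 \<alpha>3 b d (u t) (v t) (\<phi> t) (w t) (\<psi> t) (z t)
         \<le> M * energy \<rho> \<kappa>1 \<kappa>2 \<mu> \<alpha> \<beta> \<gamma> \<alpha>1 \<alpha>2 \<alpha>3 b d (u 0) (v 0) (\<phi> 0) (w 0) (\<psi> 0) (z 0)
             * exp (- \<xi> * t))))"
proof
  assume "\<exists>M \<xi>. M > 0 \<and> \<xi> > 0 \<and>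
    (\<forall>u v \<phi> w \<psi> z.
       semigroup_solution \<rho> \<kappa>1 \<kappa>2 \<mu> \<alpha> \<beta> \<gamma> \<alpha>1 \<alpha>2 \<alpha>3 b d \<tau>1 \<tau>2 \<tau>3 \<tau>4 u v \<phi> w \<psi> z \<longrightarrow>
       (\<forall>t\<ge>0. energy \<rho> \<kappa>1 \<kappa>2 \<mu> \<alpha> \<beta> \<gamma> \<alpha>1 \<alpha>2 \<alpha>3 b d (u t) (v t) (\<phi> t) (w t) (\<psi> t) (z t)
         \<le> M * energy \<rho> \<kappa>1 \<kappa>2 \<mu> \<alpha> \<beta> \<gamma> \<alpha>1 \<alpha>2 \<alpha>3 b d (u 0) (v 0) (\<phi> 0) (w 0) (\<psi> 0) (z 0)
             * exp (- \<xi> * t)))"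
  then obtain M \<xi> where M: "M > 0" and xi: "\<xi> > 0"
    and decay: "\<And>u v \<phi> w \<psi> z t. semigroup_solution \<rho> \<kappa>1 \<kappa>2 \<mu> \<alpha> \<beta> \<gamma> \<alpha>1 \<alpha>2 \<alpha>3 b d \<tau>1 \<tau>2 \<tau>3 \<tau>4 u v \<phi> w \<psi> z \<Longrightarrow> t \<ge> 0 \<Longrightarrow>
       energy \<rho> \<kappa>1 \<kappa>2 \<mu> \<alpha> \<beta> \<gamma> \<alpha>1 \<alpha>2 \<alpha>3 b d (u t) (v t) (\<phi> t) (w t) (\<psi> t) (z t)
         \<le> M * energy \<rho> \<kappa>1 \<kappa>2 \<mu> \<alpha> \<beta> \<gamma> \<alpha>1 \<alpha>2 \<alpha>3 b d (u 0) (v 0) (\<phi> 0) (w 0) (\<psi> 0) (z 0) * exp (- \<xi> * t)"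
    by blast
  define \<omega> where "\<omega> = sqrt (\<mu> / \<rho>)"
  have w: "\<omega> > 0" "\<rho> * \<omega>\<^sup>2 = \<mu>" using assms(1,4) by (simp_all add: \<omega>_def)
  \<comment> \<open>Distance below $\xi/4$ makes the decay too slow; distance below $\omega/2$ keeps the frequency
    \<open>Im l\<close> positive.\<close>
  obtain n l where n: "n > 0" and near: "norm (\<i> * \<omega> * of_nat n - l) < min (\<xi> / 4) (\<omega> / 2)"
    and root: "poly (dispersion \<rho> \<kappa>1 \<kappa>2 \<mu> \<alpha> \<beta> \<gamma> \<alpha>1 \<alpha>2 \<alpha>3 b d \<tau>1 \<tau>2 \<tau>3 \<tau>4 n) l = 0"
  proof (rule dispersion_root_near_wave_root[OF assms(1) w(2,1) assms(6,12,13,14)])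
    show "0 < min (\<xi> / 4) (\<omega> / 2)" using xi w(1) by simp
  qed
  have "Re l > - \<xi> / 4" and Im: "\<bar>\<omega> * n - Im l\<bar> < \<omega> / 2"
    using abs_Re_le_cmod[of "\<i> * \<omega> * of_nat n - l"] abs_Im_le_cmod[of "\<i> * \<omega> * of_nat n - l"] near
    by auto
  note Rel = this(1)
  have "\<omega> * n \<ge> \<omega> * 1" using n w(1) by (intro mult_left_mono) auto
  then have Iml: "Im l > 0" using Im w(1) by linarith
  then have l0: "l \<noteq> 0" by auto
  obtain A B C :: complex where nz: "\<not> (A = 0 \<and> B = 0 \<and> C = 0)" and sys:
    "\<rho> * l\<^sup>2 * A = - (\<mu> * (real n)\<^sup>2) * A - b * real n * B - d * real n * C"
    "\<kappa>1 * l\<^sup>2 * B = - (\<alpha> * (real n)\<^sup>2) * B - \<beta> * (real n)\<^sup>2 * C - b * real n * A - \<alpha>1 * B - \<alpha>3 * C - \<tau>1 * l * B - \<tau>2 * l * C"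
    "\<kappa>2 * l\<^sup>2 * C = - (\<beta> * (real n)\<^sup>2) * B - \<gamma> * (real n)\<^sup>2 * C - d * real n * A - \<alpha>3 * B - \<alpha>2 * C - \<tau>3 * l * B - \<tau>4 * l * C"
    by (rule dispersion_kernel[OF root])
  let ?E = "mode_energy \<rho> \<kappa>1 \<kappa>2 \<mu> \<alpha> \<beta> \<gamma> \<alpha>1 \<alpha>2 \<alpha>3 b d n (osc l A 0) (osc l (l * A) 0) (osc l B 0) (osc l (l * B) 0)
    (osc l C 0) (osc l (l * C) 0)"
  have pos: "?E > 0"
    using nz osc_initial_nonzero[of l] Iml by (intro mode_energy_pos[OF assms(1-3,11) n]) (metis less_irrefl)
  have bound: "\<xi> * pi / Im l * real k \<le> M" for k
  proof -
    let ?t = "2 * pi * real k / Im l"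
    have t: "?t \<ge> 0" using Iml by simp
    have "(exp (Re l * ?t))\<^sup>2 * ?E \<le> M * ?E * exp (- \<xi> * ?t)"
      using decay[OF exponential_mode_solution[OF n l0 sys] t] Iml
      by (simp only: energy_mode[OF n] osc_period mode_energy_scale less_imp_neq[symmetric] not_False_eq_True)
    then have "(exp (Re l * ?t))\<^sup>2 \<le> M * exp (- \<xi> * ?t)"
      using pos by (simp add: mult.commute mult.left_commute)
    then have "(exp (Re l * ?t))\<^sup>2 * exp (\<xi> * ?t) \<le> M"
      by (simp add: exp_minus field_simps)
    moreover have "(exp (Re l * ?t))\<^sup>2 * exp (\<xi> * ?t) = exp ((2 * Re l + \<xi>) * ?t)"
      unfolding exp_double[symmetric] exp_add[symmetric]
      by (simp add: algebra_simps add_divide_distrib)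
    moreover have "\<xi> / 2 * ?t \<le> (2 * Re l + \<xi>) * ?t"
      using Rel t by (intro mult_right_mono) auto
    moreover have "(2 * Re l + \<xi>) * ?t \<le> exp ((2 * Re l + \<xi>) * ?t)"
      using exp_ge_add_one_self[of "(2 * Re l + \<xi>) * ?t"] by linarith
    ultimately have "\<xi> / 2 * ?t \<le> M" by linarith
    then show ?thesis by (simp add: algebra_simps)
  qed
  have "\<xi> * pi / Im l > 0" using xi Iml by simp
  then obtain k :: nat where "M < k * (\<xi> * pi / Im l)" using reals_Archimedean3 by blast
  then show False using bound[of k] by (simp add: mult.commute)
qed

end
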